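(* Let $n\ge 2$, let $\Omega_1,\Omega_2\subset\mathbb{R}^n$ be connected open sets, $\Omega=\Omega_1\times\Omega_2\subset\mathbb{R}^{2n}$, and let $f\in W^{1,2}_{\mathrm{loc}}(\Omega;\mathbb{R}^{2n})$. If the weak differential $\nabla f(x)$ is split and bijective for almost every $x\in\Omega$, then $f$ is split.
   Context: Write $\mathbb{R}^{2n}=\mathbb{R}^n\times\mathbb{R}^n$. A map $f:X_1\times X_2\to\mathbb{R}^{2n}$, with $X_1,X_2\subset\mathbb{R}^n$, is called split if there are functions $f_1:X_1\to\mathbb{R}^n$, $f_2:X_2\to\mathbb{R}^n$ such that either $f(x,y)=(f_1(x),f_2(y))$ for all $(x,y)\in X_1\times X_2$, or $f(x,y)=(f_2(y),f_1(x))$ for all $(x,y)\in X_1\times X_2$. For a Sobolev function, being split is understood as usual up to modification on a null set (one of the two identities holds for a.e. $(x,y)$). A linear map $\mathbb{R}^{2n}\to\mathbb{R}^{2n}$ is split iff its matrix, in $n\times n$ blocks, has the form $\begin{pmatrix}A&0\\0&D\end{pmatrix}$ or $\begin{pmatrix}0&B\\C&0\end{pmatrix}$. *)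

theory Defs
  imports "HOL-Analysis.Analysis"
begin

text \<open>Split maps on \<open>X\<^sub>1 \<times> X\<^sub>2\<close>, where the identity is required to hold only almost everywhere,
  as is appropriate for Sobolev functions. Here \<open>real ^ 'n\<close> is Euclidean space of dimension
  \<open>CARD('n)\<close>, and its square is the Euclidean space of twice that dimension. Only the values of
  \<open>f\<^sub>1\<close> on \<open>X\<^sub>1\<close> and of \<open>f\<^sub>2\<close> on \<open>X\<^sub>2\<close> matter.\<close>

definition ae_split_on ::
  "(real ^ 'n) set \<Rightarrow> (real ^ 'n) set \<Rightarrow>
   ((real ^ 'n) \<times> (real ^ 'n) \<Rightarrow> (real ^ 'n) \<times> (real ^ 'n)) \<Rightarrow> bool"
  where "ae_split_on X\<^sub>1 X\<^sub>2 f \<longleftrightarrow>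
    (\<exists>f\<^sub>1 f\<^sub>2.
       (AE z in lebesgue_on (X\<^sub>1 \<times> X\<^sub>2). f z = (f\<^sub>1 (fst z), f\<^sub>2 (snd z))) \<or>
       (AE z in lebesgue_on (X\<^sub>1 \<times> X\<^sub>2). f z = (f\<^sub>2 (snd z), f\<^sub>1 (fst z))))"

text \<open>The two cases say that the matrix is block diagonal with diagonal blocks \<open>A\<close>, \<open>D\<close>,
  respectively block antidiagonal with upper right block \<open>B\<close> and lower left block \<open>C\<close>.\<close>

definition split_linear ::
  "((real ^ 'n) \<times> (real ^ 'n) \<Rightarrow> (real ^ 'n) \<times> (real ^ 'n)) \<Rightarrow> bool"
  where "split_linear L \<longleftrightarrow>
    (\<exists>A D :: real ^ 'n ^ 'n. \<forall>x y. L (x, y) = (A *v x, D *v y)) \<or>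
    (\<exists>B C :: real ^ 'n ^ 'n. \<forall>x y. L (x, y) = (B *v y, C *v x))"

primrec Ck :: "nat \<Rightarrow> ('a::euclidean_space \<Rightarrow> real) \<Rightarrow> bool"
  where
    "Ck 0 \<phi> \<longleftrightarrow> continuous_on UNIV \<phi>"
  | "Ck (Suc k) \<phi> \<longleftrightarrow>
      (\<forall>x. \<phi> differentiable at x) \<and> (\<forall>v. Ck k (\<lambda>x. frechet_derivative \<phi> (at x) v))"

definition test_function_on :: "'a::euclidean_space set \<Rightarrow> ('a \<Rightarrow> real) \<Rightarrow> bool"
  where "test_function_on \<Omega> \<phi> \<longleftrightarrow>
    (\<forall>k. Ck k \<phi>) \<and> compact (closure {x. \<phi> x \<noteq> 0}) \<and> closure {x. \<phi> x \<noteq> 0} \<subseteq> \<Omega>"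

definition Lp_loc ::
  "real \<Rightarrow> 'a::euclidean_space set \<Rightarrow> ('a \<Rightarrow> 'b::real_normed_vector) set"
  where "Lp_loc p \<Omega> =
    {f. f \<in> borel_measurable (lebesgue_on \<Omega>) \<and>
        (\<forall>K. compact K \<longrightarrow> K \<subseteq> \<Omega> \<longrightarrow> set_integrable lebesgue K (\<lambda>x. norm (f x) powr p))}"

definition weak_differential_on ::
  "'a::euclidean_space set \<Rightarrow> ('a \<Rightarrow> 'b::euclidean_space) \<Rightarrow> ('a \<Rightarrow> 'a \<Rightarrow>\<^sub>L 'b) \<Rightarrow> bool"
  where "weak_differential_on \<Omega> f Df \<longleftrightarrow>
    f \<in> Lp_loc 1 \<Omega> \<and> Df \<in> Lp_loc 1 \<Omega> \<and>
    (\<forall>\<phi> v. test_function_on \<Omega> \<phi> \<longrightarrow>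
      (LINT x:\<Omega>|lebesgue. \<phi> x *\<^sub>R blinfun_apply (Df x) v) =
      - (LINT x:\<Omega>|lebesgue. frechet_derivative \<phi> (at x) v *\<^sub>R f x))"

definition W1p_loc ::
  "real \<Rightarrow> 'a::euclidean_space set \<Rightarrow> ('a \<Rightarrow> 'b::euclidean_space) set"
  where "W1p_loc p \<Omega> =
    {f. f \<in> Lp_loc p \<Omega> \<and> (\<exists>Df. weak_differential_on \<Omega> f Df \<and> Df \<in> Lp_loc p \<Omega>)}"

end

theory Submission imports Defs begin

text \<open>
  Write \<open>f = (u, v)\<close> with \<open>u\<close> and \<open>v\<close> valued in \<open>\<real>\<^sup>n\<close>. Since \<open>f\<close> is locally in \<open>W\<^sup>1\<^sup>,\<^sup>2\<close>, the
  two-forms \<open>du\<^sub>i \<and> du\<^sub>j\<close> have locally integrable coefficients and are weakly closed. As \<open>\<nabla>f\<close> is split,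
  their mixed \<open>dx \<and> dy\<close> coefficients vanish, so closedness says that the \<open>dx \<and> dx\<close> coefficients, which
  are the \<open>2 \<times> 2\<close> minors of \<open>\<nabla>\<^sub>x u\<close>, do not depend on \<open>y\<close>, and that the \<open>dy \<and> dy\<close> coefficients do not
  depend on \<open>x\<close>. As \<open>\<nabla>f\<close> is bijective and \<open>n \<ge> 2\<close>, the former are not all zero exactly where \<open>\<nabla>f\<close> is
  block diagonal, and the latter exactly where it is block antidiagonal. The set of points of diagonal
  type is therefore described both by a condition on \<open>x\<close> and by a condition on \<open>y\<close>, so it is null or
  has null complement. Then \<open>\<nabla>\<^sub>y u = 0\<close> and \<open>\<nabla>\<^sub>x v = 0\<close> almost everywhere, or the other way round.
\<close>

subsection \<open>Smooth expressions and test functions\<close>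

text \<open>The obstacle is that the type of \<open>Df\<close> may switch measurably from point to
  point, and the vanishing of a block at some points says nothing about the others. A minor survives
  such switches: in the closedness identity for two directions in one factor and one in the other,
  the two remaining minors are mixed and vanish at points of either type. The exponent 2 is what
  makes a product of two derivatives locally integrable, and for n = 1 all minors are trivially
  zero. Closedness, obvious for smooth maps, is proved without smoothing the map: one factor of each
  product is shifted by z, and the alternating sum becomes a function of z that is continuous at 0
  because the derivatives are locally in L^2. Near 0 it integrates to zero against all test
  functions of z, so its value at 0 is zero.\<close>

definition exp_bump :: "real poly \<Rightarrow> real \<Rightarrow> real"
  where "exp_bump p t = (if t > 0 then poly p (1 / t) * exp (- (1 / t)) else 0)"

text \<open>Under x = 1/t this is the decay of a polynomial times exp(-x) at infinity.\<close>

lemma exp_bump_at_right: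
  fixes p :: "real poly"
  shows "((\<lambda>t. poly p (1 / t) * exp (- (1 / t))) \<longlongrightarrow> 0) (at_right 0)"
proof -
  have "((\<lambda>x. poly p x * exp (- x)) \<longlongrightarrow> 0) at_top"
  proof -
    have "((\<lambda>x. \<Sum>i\<le>degree p. coeff p i * (x ^ i / exp x)) \<longlongrightarrow> (\<Sum>i\<le>degree p. coeff p i * 0)) at_top"
      by (intro tendsto_sum tendsto_mult tendsto_const tendsto_power_div_exp_0)
    then show ?thesis
      by (simp add: poly_altdef sum_distrib_right exp_minus divide_inverse mult.assoc)
  qed
  then have "((\<lambda>x. poly p (inverse x) * exp (- inverse x)) \<longlongrightarrow> 0) (at_right 0)"
    by (rule filterlim_compose[OF _ filterlim_inverse_at_top_right])
  then show ?thesis by (simp add: divide_inverse)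
qed

text \<open>The polynomial on the right comes from the chain rule: with \<open>s = 1 / t\<close> one has
  \<open>d/dt (p(s) e\<^sup>-\<^sup>s) = s\<^sup>2 (p(s) - p'(s)) e\<^sup>-\<^sup>s\<close>.\<close>

lemma exp_bump_has_real_derivative:
  "(exp_bump p has_real_derivative exp_bump ([:0, 0, 1:] * (p - pderiv p)) t) (at t)"
proof -
  consider "t > 0" | "t = 0" | "t < 0" by linarith
  then show ?thesis
  proof cases
    case 1
    have "((\<lambda>t. poly p (1 / t) * exp (- (1 / t))) has_real_derivative
        exp_bump ([:0, 0, 1:] * (p - pderiv p)) t) (at t)"
      unfolding exp_bump_def using 1
      by (auto intro!: derivative_eq_intros simp: field_simps power2_eq_square)
    then show ?thesis
      by (rule has_field_derivative_transform_within_open[of _ _ _ "{0<..}"])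
        (use 1 in \<open>auto simp: exp_bump_def\<close>)
  next
    case 2
    have "((\<lambda>h. exp_bump p h / h) \<longlongrightarrow> 0) (at 0)"
    proof (rule filterlim_split_at)
      show "((\<lambda>h. exp_bump p h / h) \<longlongrightarrow> 0) (at_left 0)"
        by (rule tendsto_eventually) (auto simp: eventually_at_left_field exp_bump_def intro: exI[of _ "-1"])
      \<comment> \<open>Dividing by \<open>h\<close> replaces \<open>p\<close> by
        \<open>[:0, 1:] * p\<close>, so the difference quotient at 0 is again of the shape treated
        in \<open>exp_bump_at_right\<close>.\<close>
      have "((\<lambda>t. poly ([:0, 1:] * p) (1 / t) * exp (- (1 / t))) \<longlongrightarrow> 0) (at_right 0)"
        by (rule exp_bump_at_right)
      then show "((\<lambda>h. exp_bump p h / h) \<longlongrightarrow> 0) (at_right 0)"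
        by (rule Lim_transform_eventually)
          (auto simp: eventually_at_right_field exp_bump_def intro: exI[of _ 1])
    qed
    then show ?thesis using 2
      by (simp add: exp_bump_def DERIV_def)
  next
    case 3
    have "((\<lambda>t. 0) has_real_derivative exp_bump ([:0, 0, 1:] * (p - pderiv p)) t) (at t)"
      using 3 by (simp add: exp_bump_def)
    then show ?thesis
      by (rule has_field_derivative_transform_within_open[of _ _ _ "{..<0}"])
        (use 3 in \<open>auto simp: exp_bump_def\<close>)
  qed
qed

text \<open>The statement tests weak derivatives against smooth functions only. It is enough to use those
  given by the following expressions: the class is closed under directional derivatives \<open>pd\<close>, and
  mixed derivatives commute by structural induction. \<open>Lin c w\<close> denotes the affine function
  \<open>x \<mapsto> c + x \<bullet> w\<close>.\<close>

datatype 'a sexp =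
  Lin real 'a | Add "'a sexp" "'a sexp" | Mul "'a sexp" "'a sexp" | Bump "real poly" "'a sexp"

primrec ev :: "'a::euclidean_space sexp \<Rightarrow> 'a \<Rightarrow> real" where
  "ev (Lin c w) x = c + x \<bullet> w"
| "ev (Add a b) x = ev a x + ev b x"
| "ev (Mul a b) x = ev a x * ev b x"
| "ev (Bump p a) x = exp_bump p (ev a x)"

primrec pd :: "'a::euclidean_space \<Rightarrow> 'a sexp \<Rightarrow> 'a sexp" where
  "pd v (Lin c w) = Lin (v \<bullet> w) 0"
| "pd v (Add a b) = Add (pd v a) (pd v b)"
| "pd v (Mul a b) = Add (Mul (pd v a) b) (Mul a (pd v b))"
| "pd v (Bump p a) = Mul (Bump ([:0, 0, 1:] * (p - pderiv p)) a) (pd v a)"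

primrec compose_affine :: "real \<Rightarrow> 'a::euclidean_space \<Rightarrow> 'a sexp \<Rightarrow> 'a sexp" where
  "compose_affine s t (Lin c w) = Lin (c + t \<bullet> w) (s *\<^sub>R w)"
| "compose_affine s t (Add a b) = Add (compose_affine s t a) (compose_affine s t b)"
| "compose_affine s t (Mul a b) = Mul (compose_affine s t a) (compose_affine s t b)"
| "compose_affine s t (Bump p a) = Bump p (compose_affine s t a)"

lemma ev_affine: "ev (compose_affine s t a) x = ev a (t + s *\<^sub>R x)"
  by (induction a) (auto simp: inner_left_distrib)

lemma ev_pd_affine: "ev (pd v (compose_affine s t a)) x = s * ev (pd v a) (t + s *\<^sub>R x)"
  by (induction a) (auto simp: ev_affine algebra_simps)

lemma ev_has_derivative: "(ev a has_derivative (\<lambda>v. ev (pd v a) x)) (at x)"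
proof (induction a)
  case (Bump p a)
  have "((\<lambda>x. exp_bump p (ev a x)) has_derivative
     (\<lambda>v. ev (pd v a) x * exp_bump ([:0, 0, 1:] * (p - pderiv p)) (ev a x))) (at x)"
    by (rule DERIV_compose_FDERIV[OF exp_bump_has_real_derivative Bump])
  then show ?case by (simp add: mult.commute ev.simps[abs_def])
qed (auto intro!: derivative_eq_intros simp: ev.simps[abs_def] algebra_simps)

lemma frechet_derivative_ev: "frechet_derivative (ev a) (at x) = (\<lambda>v. ev (pd v a) x)"
  using frechet_derivative_at[OF ev_has_derivative] by metis

text \<open>Directional derivatives of expressions are expressions, so the induction on
  \<open>k\<close> with \<open>a\<close> arbitrary closes.\<close>

lemma Ck_ev: "Ck k (ev a)"
proof (induction k arbitrary: a)
  case 0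
  then show ?case
    using ev_has_derivative has_derivative_continuous
    by (fastforce simp: continuous_on_eq_continuous_at)
next
  case (Suc k)
  then show ?case
    using ev_has_derivative by (auto simp: frechet_derivative_ev differentiable_def)
qed

lemma continuous_on_ev [continuous_intros]: "continuous_on S (ev a)"
  using Ck_ev[of 0 a] continuous_on_subset by auto

lemma borel_measurable_ev [measurable]: "ev a \<in> borel_measurable borel"
  by (simp add: borel_measurable_continuous_onI continuous_on_ev)

lemma pd_commute: "ev (pd v (pd w a)) x = ev (pd w (pd v a)) x"
  by (induction a) (auto simp: algebra_simps)

lemma pd_scaleR: "ev (pd (s *\<^sub>R v) a) x = s * ev (pd v a) x"
  by (induction a) (auto simp: algebra_simps)

text \<open>Any compact set containing the support is allowed, so that one \<open>K\<close> serves
  an expression and all its derivatives.\<close>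

definition vanishes_off :: "'a::euclidean_space set \<Rightarrow> 'a sexp \<Rightarrow> bool"
  where "vanishes_off K a \<longleftrightarrow> compact K \<and> (\<forall>x. x \<notin> K \<longrightarrow> ev a x = 0)"

definition tfun :: "'a::euclidean_space set \<Rightarrow> 'a sexp \<Rightarrow> bool"
  where "tfun U a \<longleftrightarrow> (\<exists>K \<subseteq> U. vanishes_off K a)"

lemma tfun_imp_test_function_on:
  assumes "tfun U a"
  shows "test_function_on U (ev a)"
proof -
  obtain K where K: "K \<subseteq> U" "compact K" "\<And>x. x \<notin> K \<Longrightarrow> ev a x = 0"
    using assms by (auto simp: tfun_def vanishes_off_def)
  have "closure {x. ev a x \<noteq> 0} \<subseteq> K"
    by (rule closure_minimal) (use K compact_imp_closed in auto)
  then show ?thesis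
    using K compact_closure unfolding test_function_on_def
    by (auto simp: Ck_ev intro: bounded_subset[OF compact_imp_bounded])
qed

text \<open>The complement of \<open>K\<close> is open, so the function is locally constant zero
  there.\<close>

lemma vanishes_off_pd:
  assumes "vanishes_off K a" shows "vanishes_off K (pd v a)"
proof -
  have "ev (pd v a) x = 0" if "x \<notin> K" for x
  proof -
    have "open (- K)" using assms by (auto simp: vanishes_off_def compact_imp_closed)
    have "((\<lambda>x. 0) has_derivative (\<lambda>v. 0)) (at x)" by simp
    then have "(ev a has_derivative (\<lambda>v. 0)) (at x)"
      by (rule has_derivative_transform_within_open[OF _ \<open>open (- K)\<close>])
        (use that assms in \<open>auto simp: vanishes_off_def\<close>)
    then have "(\<lambda>v. ev (pd v a) x) = (\<lambda>v. 0)"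
      by (rule has_derivative_unique[OF ev_has_derivative])
    then show ?thesis by metis
  qed
  then show ?thesis using assms by (auto simp: vanishes_off_def)
qed

lemma ev_bounded:
  assumes "vanishes_off K a"
  obtains B where "\<And>x. \<bar>ev a x\<bar> \<le> B" "B > 0"
proof -
  have "bounded (ev a ` K)"
    using assms by (auto simp: vanishes_off_def intro!: compact_imp_bounded compact_continuous_image continuous_on_ev)
  then obtain B where "B > 0" "\<And>x. x \<in> K \<Longrightarrow> \<bar>ev a x\<bar> \<le> B"
    by (auto simp: bounded_pos)
  then have "\<bar>ev a x\<bar> \<le> B" for x
    using assms by (cases "x \<in> K") (auto simp: vanishes_off_def)
  with \<open>B > 0\<close> show ?thesis using that by blast
qed

subsection \<open>The fundamental lemma of the calculus of variations\<close>

text \<open>Borel measurability on the whole space, with \<open>lborel\<close>, lets Fubini be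
  applied directly. Sobolev data, which are only Lebesgue measurable, enter through Borel
  representatives.\<close>

definition locint :: "'a::euclidean_space set \<Rightarrow> ('a \<Rightarrow> real) \<Rightarrow> bool"
  where "locint U g \<longleftrightarrow> g \<in> borel_measurable borel \<and>
    (\<forall>K. compact K \<longrightarrow> K \<subseteq> U \<longrightarrow> set_integrable lborel K g)"

lemma locint_measurable: "locint U g \<Longrightarrow> g \<in> borel_measurable borel"
  by (simp add: locint_def)

lemma locint_subset: "locint U g \<Longrightarrow> V \<subseteq> U \<Longrightarrow> locint V g"
  by (auto simp: locint_def)

lemma locint_add: "locint U f \<Longrightarrow> locint U g \<Longrightarrow> locint U (\<lambda>x. f x + g x)"
  by (auto simp: locint_def)

lemma locint_diff: "locint U f \<Longrightarrow> locint U g \<Longrightarrow> locint U (\<lambda>x. f x - g x)"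
  by (auto simp: locint_def)

lemma locint_bounded_mult:
  assumes g: "locint U g" and K: "compact K" "K \<subseteq> U"
    and b [measurable]: "b \<in> borel_measurable borel"
    and B: "\<And>x. \<bar>b x\<bar> \<le> B" and b0: "\<And>x. x \<notin> K \<Longrightarrow> b x = 0"
  shows "integrable lborel (\<lambda>x. b x * g x)"
proof (rule Bochner_Integration.integrable_bound)
  have [measurable]: "g \<in> borel_measurable borel" by (rule locint_measurable[OF g])
  show "integrable lborel (\<lambda>x. B * (indicator K x *\<^sub>R g x))"
    using g K by (auto simp: locint_def set_integrable_def)
  show "(\<lambda>x. b x * g x) \<in> borel_measurable lborel" by measurable
  have "B \<ge> 0" using B[of 0] by linarith
  then show "AE x in lborel. norm (b x * g x) \<le> norm (B * (indicator K x *\<^sub>R g x))"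
    using B b0 by (intro always_eventually) (auto simp: abs_mult indicator_def intro!: mult_right_mono)
qed

lemma locint_tfun:
  assumes "locint U g" "tfun U a"
  shows "integrable lborel (\<lambda>x. ev a x * g x)"
proof -
  obtain K where K: "K \<subseteq> U" "vanishes_off K a" using assms by (auto simp: tfun_def)
  moreover obtain B where "\<And>x. \<bar>ev a x\<bar> \<le> B" using ev_bounded[OF K(2)] by metis
  ultimately show ?thesis
    by (intro locint_bounded_mult[OF assms(1), of K]) (auto simp: vanishes_off_def)
qed

lemma tfun_pd: "tfun U a \<Longrightarrow> tfun U (pd v a)"
  by (auto simp: tfun_def intro: vanishes_off_pd)

section \<open>Smooth bumps exhausting a box\<close>

lemma ex_ev_prod:
  assumes "finite I" "\<And>i. i \<in> I \<Longrightarrow> \<exists>e. \<forall>x. ev e x = f i x"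
  shows "\<exists>e. \<forall>x::'a::euclidean_space. ev e x = (\<Prod>i\<in>I. f i x)"
  using assms
proof (induction I rule: finite_induct)
  case empty
  show ?case by (rule exI[of _ "Lin 1 0"]) simp
next
  case (insert j I)
  have "\<exists>e. \<forall>x. ev e x = f j x" "\<exists>e. \<forall>x. ev e x = (\<Prod>i\<in>I. f i x)"
    using insert.prems insert.IH by blast+
  then obtain e e' where "\<forall>x. ev e x = f j x" "\<forall>x. ev e' x = (\<Prod>i\<in>I. f i x)" by metis
  then show ?case using insert.hyps by (intro exI[of _ "Mul e e'"]) simp
qed

text \<open>Increasing \<open>n\<close> makes the bump steeper without moving its support: inside
  the box each factor exp(-1/(n t)) tends to 1. The indicator of a box is thus a bounded limit of
  expressions, with no convolution involved.\<close>

definition box_bump :: "real \<Rightarrow> 'a::euclidean_space \<Rightarrow> 'a \<Rightarrow> 'a \<Rightarrow> real"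
  where "box_bump n a b x =
    (\<Prod>i\<in>Basis. exp_bump 1 (n * (x \<bullet> i - a \<bullet> i)) * exp_bump 1 (n * (b \<bullet> i - x \<bullet> i)))"

lemma box_bump_ev: "\<exists>e. \<forall>x. ev e x = box_bump n a b x"
  unfolding box_bump_def
proof (rule ex_ev_prod[OF finite_Basis])
  fix i :: 'a
  show "\<exists>e. \<forall>x. ev e x = exp_bump 1 (n * (x \<bullet> i - a \<bullet> i)) * exp_bump 1 (n * (b \<bullet> i - x \<bullet> i))"
    by (rule exI[of _ "Mul (Bump 1 (Lin (- n * (a \<bullet> i)) (n *\<^sub>R i))) (Bump 1 (Lin (n * (b \<bullet> i)) (- n *\<^sub>R i)))"])
      (simp add: algebra_simps)
qed

lemma exp_bump_1_bounds: "0 \<le> exp_bump 1 t" "exp_bump 1 t \<le> 1"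
  by (auto simp: exp_bump_def)

lemma box_bump_bounds: "0 \<le> box_bump n a b x" "box_bump n a b x \<le> 1"
  unfolding box_bump_def
  by (auto intro!: prod_nonneg prod_le_1 mult_nonneg_nonneg mult_le_one simp: exp_bump_1_bounds)

lemma box_bump_outside:
  assumes "n > 0" "x \<notin> box a b" shows "box_bump n a b x = 0"
proof -
  obtain i where "i \<in> Basis" "x \<bullet> i \<le> a \<bullet> i \<or> b \<bullet> i \<le> x \<bullet> i"
    using assms by (auto simp: mem_box not_less)
  moreover from this have "exp_bump 1 (n * (x \<bullet> i - a \<bullet> i)) * exp_bump 1 (n * (b \<bullet> i - x \<bullet> i)) = 0"
    using assms by (auto simp: exp_bump_def zero_less_mult_iff)
  ultimately show ?thesis by (auto simp: box_bump_def prod_zero_iff)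
qed

lemma exp_bump_1_tendsto:
  assumes "t > 0" shows "(\<lambda>n. exp_bump 1 (real (Suc n) * t)) \<longlonglongrightarrow> 1"
proof -
  have "(\<lambda>n. exp (- ((1 / t) * (1 / real (Suc n))))) \<longlonglongrightarrow> exp (- ((1 / t) * 0))"
    by (intro tendsto_intros LIMSEQ_Suc[OF lim_1_over_n])
  moreover have "exp_bump 1 (real (Suc n) * t) = exp (- ((1 / t) * (1 / real (Suc n))))" for n
    using assms by (simp add: exp_bump_def zero_less_mult_iff mult.commute)
  ultimately show ?thesis by simp
qed

lemma box_bump_tendsto:
  fixes x :: "'a::euclidean_space"
  shows "(\<lambda>n. box_bump (real (Suc n)) a b x) \<longlonglongrightarrow> indicator (box a b) x"
proof (cases "x \<in> box a b")
  case True
  have "(\<lambda>n. box_bump (real (Suc n)) a b x) \<longlonglongrightarrow> (\<Prod>i\<in>(Basis :: 'a set). 1 * 1)"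
    unfolding box_bump_def
    by (intro tendsto_prod tendsto_mult exp_bump_1_tendsto) (use True in \<open>simp_all add: mem_box\<close>)
  then show ?thesis using True by simp
next
  case False
  then show ?thesis by (simp add: box_bump_outside)
qed

text \<open>Boxes form an intersection-stable generator of the Borel sets, so a Dynkin argument
  passes from boxes to all Borel sets. Its complement step uses the integral over the whole space,
  obtained from an exhaustion by boxes.\<close>

lemma AE_zero_if_box_integrals_zero:
  fixes h :: "'a::euclidean_space \<Rightarrow> real"
  assumes h: "integrable lborel h" and box: "\<And>a b. (LINT x:box a b|lborel. h x) = 0"
  shows "AE x in lborel. h x = 0"
proof (rule sigma_finite_measure.density_zero[OF lborel.sigma_finite_measure_axioms h])
  note hm [measurable] = borel_measurable_integrable[OF h]
  have si: "set_integrable lborel A h" if "A \<in> sets borel" for A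
    unfolding set_integrable_def by (rule integrable_mult_indicator) (use h that in auto)
  have "(\<lambda>n. LINT x|lborel. indicator (box (- (real n *\<^sub>R One)) (real n *\<^sub>R One)) x *\<^sub>R h x)
      \<longlonglongrightarrow> (LINT x|lborel. h x)"
  proof (rule integral_dominated_convergence[where w="\<lambda>x. norm (h x)"])
    show "AE x in lborel. (\<lambda>n. indicator (box (- (real n *\<^sub>R One)) (real n *\<^sub>R One)) x *\<^sub>R h x) \<longlonglongrightarrow> h x"
    proof (intro always_eventually allI)
      fix x :: 'a
      obtain m :: nat where m: "norm x < real m" using reals_Archimedean2 by blast
      have "x \<in> box (- (real n *\<^sub>R One)) (real n *\<^sub>R One)" if "n \<ge> m" for n
      proof -
        have "\<bar>x \<bullet> i\<bar> < real n" if "i \<in> Basis" for i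
          using Basis_le_norm[OF that, of x] m \<open>n \<ge> m\<close> by linarith
        then show ?thesis by (simp add: mem_box abs_less_iff minus_less_iff)
      qed
      then have "\<forall>\<^sub>F n in sequentially. indicator (box (- (real n *\<^sub>R One)) (real n *\<^sub>R One)) x *\<^sub>R h x = h x"
        unfolding eventually_sequentially by (intro exI[of _ m]) auto
      then show "(\<lambda>n. indicator (box (- (real n *\<^sub>R One)) (real n *\<^sub>R One)) x *\<^sub>R h x) \<longlonglongrightarrow> h x"
        by (rule tendsto_eventually)
    qed
  qed (use h in \<open>simp_all add: indicator_def\<close>)
  then have univ: "(LINT x|lborel. h x) = 0"
    using box by (simp add: set_lebesgue_integral_def LIMSEQ_const_iff)
  fix A :: "'a set" assume "A \<in> sets lborel"
  then have A: "A \<in> sigma_sets UNIV (range (\<lambda>(a, b). box a b :: 'a set))"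
    by (simp add: borel_eq_box)
  show "(LINT x:A|lborel. h x) = 0"
  proof (rule sigma_sets_induct_disjoint[OF _ _ A])
    show "Int_stable (range (\<lambda>(a, b). box a b :: 'a set))"
      by (auto simp: Int_stable_def box_Int_box)
  next
    fix A assume "A \<in> sigma_sets UNIV (range (\<lambda>(a, b). box a b :: 'a set))" and 0: "(LINT x:A|lborel. h x) = 0"
    then have "A \<in> sets borel" by (simp add: borel_eq_box)
    then have "(LINT x:A \<union> (UNIV - A)|lborel. h x) = (LINT x:A|lborel. h x) + (LINT x:UNIV - A|lborel. h x)"
      by (intro set_integral_Un si) auto
    then show "(LINT x:UNIV - A|lborel. h x) = 0"
      using 0 univ by (simp add: set_lebesgue_integral_def)
  next
    fix F :: "nat \<Rightarrow> 'a set"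
    assume "disjoint_family F" "range F \<subseteq> sigma_sets UNIV (range (\<lambda>(a, b). box a b :: 'a set))"
      and 0: "\<And>i. (LINT x:F i|lborel. h x) = 0"
    then have "\<And>i. F i \<in> sets borel" by (auto simp: borel_eq_box)
    then have "(LINT x:(\<Union>i. F i)|lborel. h x) = (\<Sum>i. (LINT x:F i|lborel. h x))"
      using \<open>disjoint_family F\<close>
      by (intro lebesgue_integral_countable_add si) (auto simp: disjoint_family_on_def)
    then show "(LINT x:(\<Union>i. F i)|lborel. h x) = 0" using 0 by simp
  qed (use box in \<open>auto simp: set_lebesgue_integral_def\<close>)
qed

text \<open>Dominated convergence along \<open>box_bump\<close> turns the hypothesis into vanishing
  integrals over boxes whose closed box lies in \<open>U\<close>. Countably many closed boxes cover
  \<open>U\<close>, and on each of them \<open>g\<close> is integrable.\<close>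

lemma fundamental_lemma:
  fixes g :: "'a::euclidean_space \<Rightarrow> real"
  assumes "open U" and g: "locint U g"
    and zero: "\<And>a. tfun U a \<Longrightarrow> (LINT x|lborel. ev a x * g x) = 0"
  shows "AE x in lborel. x \<in> U \<longrightarrow> g x = 0"
proof -
  have [measurable]: "g \<in> borel_measurable borel" by (rule locint_measurable[OF g])
  have box0: "(LINT x:box a b|lborel. g x) = 0" if "cbox a b \<subseteq> U" for a b
  proof -
    have ic: "integrable lborel (\<lambda>x. indicator (cbox a b) x *\<^sub>R g x)"
      using g that by (auto simp: locint_def set_integrable_def)
    have "(\<lambda>n. LINT x|lborel. box_bump (real (Suc n)) a b x * g x)
      \<longlonglongrightarrow> (LINT x|lborel. indicator (box a b) x * g x)"
    proof (rule integral_dominated_convergence[where w="\<lambda>x. norm (indicator (cbox a b) x *\<^sub>R g x)"])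
      fix n
      obtain e where e: "\<And>x. ev e x = box_bump (real (Suc n)) a b x" using box_bump_ev by metis
      have "(\<lambda>x. ev e x * g x) \<in> borel_measurable lborel" by measurable
      then show "(\<lambda>x. box_bump (real (Suc n)) a b x * g x) \<in> borel_measurable lborel" by (simp add: e)
      have "\<bar>box_bump (real (Suc n)) a b x\<bar> \<le> indicator (cbox a b) x" for x
        using box_bump_bounds[of "real (Suc n)" a b x] box_bump_outside[of "real (Suc n)" x a b]
          box_subset_cbox[of a b] by (auto simp: indicator_def)
      then show "AE x in lborel. norm (box_bump (real (Suc n)) a b x * g x) \<le> norm (indicator (cbox a b) x *\<^sub>R g x)"
        by (intro always_eventually allI) (auto simp: abs_mult intro!: mult_right_mono)
      show "AE x in lborel. (\<lambda>n. box_bump (real (Suc n)) a b x * g x) \<longlonglongrightarrow> indicator (box a b) x * g x"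
        by (intro always_eventually allI tendsto_mult tendsto_const box_bump_tendsto)
    qed (use ic in auto)
    moreover have "(LINT x|lborel. box_bump (real (Suc n)) a b x * g x) = 0" for n
    proof -
      obtain e where e: "\<And>x. ev e x = box_bump (real (Suc n)) a b x" using box_bump_ev by metis
      have "tfun U e" unfolding tfun_def vanishes_off_def
        using that box_subset_cbox[of a b]
        by (intro exI[of _ "cbox a b"]) (auto simp: e intro!: box_bump_outside)
      from zero[OF this] show ?thesis by (simp add: e)
    qed
    ultimately show ?thesis by (simp add: set_lebesgue_integral_def LIMSEQ_const_iff)
  qed
  obtain \<D> where \<D>: "countable \<D>" "\<D> \<subseteq> Pow U" "\<And>X. X \<in> \<D> \<Longrightarrow> \<exists>a b. X = cbox a b" "\<Union>\<D> = U"
    using open_countable_Union_open_cbox[OF \<open>open U\<close>] by metis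
  have "AE x in lborel. x \<in> X \<longrightarrow> g x = 0" if X: "X \<in> \<D>" for X
  proof -
    obtain c d where cd: "X = cbox c d" using \<D>(3)[OF X] by auto
    with X \<D>(2) have sub: "cbox c d \<subseteq> U" by auto
    \<comment> \<open>The cut-off is by the open box, whose intersection with \<open>box a b\<close>
      is again an open box; the boundary is restored as a null set.\<close>
    have "AE x in lborel. indicator (box c d) x * g x = 0"
    proof (rule AE_zero_if_box_integrals_zero)
      have "set_integrable lborel (cbox c d) g" using g sub by (auto simp: locint_def)
      then have "set_integrable lborel (box c d) g"
        by (rule set_integrable_subset) (auto simp: box_subset_cbox)
      then show "integrable lborel (\<lambda>x. indicator (box c d) x * g x)"
        by (simp add: set_integrable_def)
      fix a b :: 'a
      obtain e f where ef: "box a b \<inter> box c d = box e f" using box_Int_box[of a b c d] by blast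
      show "(LINT x:box a b|lborel. indicator (box c d) x * g x) = 0"
      proof (cases "box e f = {}")
        case True
        then have "indicator (box a b) x *\<^sub>R (indicator (box c d) x * g x) = 0" for x
          using ef by (auto simp: indicator_def)
        then show ?thesis unfolding set_lebesgue_integral_def by (simp only: integral_zero)
      next
        case False
        \<comment> \<open>Only a nonempty \<open>box e f\<close> has \<open>cbox e f\<close> as its
          closure, hence the case distinction.\<close>
        have "closure (box e f) \<subseteq> cbox c d"
          using ef box_subset_cbox[of c d] by (intro closure_minimal) auto
        then have "cbox e f \<subseteq> cbox c d" using False by (simp add: closure_box)
        then have "(LINT x:box e f|lborel. g x) = 0" using sub box0 by blast
        moreover have "indicator (box a b) x *\<^sub>R (indicator (box c d) x * g x) = indicator (box e f) x *\<^sub>R g x" for x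
          unfolding ef[symmetric] by (simp add: indicator_inter_arith)
        ultimately show ?thesis unfolding set_lebesgue_integral_def by (simp only:)
      qed
    qed
    moreover have "AE x in lborel. x \<notin> cbox c d - box c d"
      by (rule AE_not_in) (simp add: null_sets_def emeasure_Diff emeasure_lborel_box_eq emeasure_lborel_cbox_eq box_subset_cbox)
    ultimately show ?thesis unfolding cd by eventually_elim (auto simp: indicator_def split: if_splits)
  qed
  then have "AE x in lborel. \<forall>X\<in>\<D>. x \<in> X \<longrightarrow> g x = 0"
    by (subst AE_ball_countable[OF \<D>(1)]) blast
  then show ?thesis by eventually_elim (use \<D>(4) in auto)
qed

subsection \<open>Invariance along directions of vanishing weak derivative\<close>

text \<open>Both signs occur later: \<open>s = 1\<close> for translations, \<open>s = -1\<close> for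
  substitutions y = x - z.\<close>

lemma lborel_distr_isometry:
  fixes t :: "'a::euclidean_space"
  assumes "\<bar>s\<bar> = 1" shows "distr lborel borel (\<lambda>x. t + s *\<^sub>R x) = lborel"
  using lborel_affine[of s t] assms by (auto simp: density_1)

lemma lborel_integral_isometry:
  fixes f :: "'a::euclidean_space \<Rightarrow> real"
  assumes "\<bar>s\<bar> = 1" and f: "f \<in> borel_measurable borel"
  shows "(LINT x|lborel. f (t + s *\<^sub>R x)) = (LINT x|lborel. f x)"
proof -
  have "(LINT x|distr lborel borel (\<lambda>x. t + s *\<^sub>R x). f x) = (LINT x|lborel. f (t + s *\<^sub>R x))"
    by (rule integral_distr) (use f in auto)
  then show ?thesis using assms by (simp add: lborel_distr_isometry)
qed

lemma lborel_integrable_isometry: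
  fixes f :: "'a::euclidean_space \<Rightarrow> real"
  assumes "\<bar>s\<bar> = 1" and f: "integrable lborel f"
  shows "integrable lborel (\<lambda>x. f (t + s *\<^sub>R x))"
proof (rule integrable_distr[where M'=borel and T="\<lambda>x. t + s *\<^sub>R x" and f=f])
  show "integrable (distr lborel borel (\<lambda>x. t + s *\<^sub>R x)) f"
    unfolding lborel_distr_isometry[OF assms(1)] by (rule f)
qed simp

lemma AE_lborel_isometry:
  fixes t :: "'a::euclidean_space"
  assumes "\<bar>s\<bar> = 1" and "AE x in lborel. P x"
  shows "AE x in lborel. P (t + s *\<^sub>R x)"
proof (rule AE_distrD[of "\<lambda>x. t + s *\<^sub>R x" lborel borel P])
  show "AE x in distr lborel borel (\<lambda>x. t + s *\<^sub>R x). P x"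
    unfolding lborel_distr_isometry[OF assms(1)] by (rule assms)
qed simp

lemma (in pair_sigma_finite) integrable_mult_pair:
  fixes f :: "'a \<Rightarrow> real" and g :: "'b \<Rightarrow> real"
  assumes f: "integrable M1 f" and g: "integrable M2 g"
  shows "integrable (M1 \<Otimes>\<^sub>M M2) (\<lambda>(x, y). f x * g y)"
proof (rule Fubini_integrable)
  show "(\<lambda>(x, y). f x * g y) \<in> borel_measurable (M1 \<Otimes>\<^sub>M M2)"
    using borel_measurable_integrable[OF f] borel_measurable_integrable[OF g] by measurable
qed (use f g in \<open>auto simp: abs_mult\<close>)

text \<open>The kernel is dominated by a constant on K \<times> L, so joint integrability reduces to
  that of a product of two truncated functions.\<close>

lemma (in pair_sigma_finite) integrable_kernel:
  fixes f :: "'a \<Rightarrow> real" and g :: "'b \<Rightarrow> real"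
  assumes k [measurable]: "k \<in> borel_measurable (M1 \<Otimes>\<^sub>M M2)"
    and B: "\<And>x y. \<bar>k (x, y)\<bar> \<le> B" and k0: "\<And>x y. \<not> (x \<in> K \<and> y \<in> L) \<Longrightarrow> k (x, y) = 0"
    and [measurable]: "f \<in> borel_measurable M1" "g \<in> borel_measurable M2"
    and f: "set_integrable M1 K f" and g: "set_integrable M2 L g"
  shows "integrable (M1 \<Otimes>\<^sub>M M2) (\<lambda>(x, y). k (x, y) * (f x * g y))"
proof (rule Bochner_Integration.integrable_bound)
  show "integrable (M1 \<Otimes>\<^sub>M M2) (\<lambda>z. B * (case z of (x, y) \<Rightarrow> (indicator K x *\<^sub>R f x) * (indicator L y *\<^sub>R g y)))"
    by (intro integrable_mult_right integrable_mult_pair f[unfolded set_integrable_def] g[unfolded set_integrable_def])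
  have "B \<ge> 0" using B[of undefined undefined] by linarith
  then show "AE z in M1 \<Otimes>\<^sub>M M2. norm (case z of (x, y) \<Rightarrow> k (x, y) * (f x * g y))
      \<le> norm (B * (case z of (x, y) \<Rightarrow> (indicator K x *\<^sub>R f x) * (indicator L y *\<^sub>R g y)))"
    using B k0 by (intro always_eventually) (auto simp: abs_mult indicator_def intro!: mult_right_mono)
qed measurable

text \<open>The integral of a(z - t h) g(z) has t-derivative zero by hypothesis, so it agrees at t =
  0 and t = 1. The fundamental theorem of calculus is applied to the test function and Fubini does
  the rest, so \<open>g\<close> is never differentiated. The condition on \<open>V\<close> keeps all
  intermediate translates supported in \<open>U\<close>.\<close>

lemma translation_invariance:
  fixes g :: "'a::euclidean_space \<Rightarrow> real"
  assumes "open U" and g: "locint U g"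
    and zero: "\<And>a. tfun U a \<Longrightarrow> (LINT x|lborel. ev (pd h a) x * g x) = 0"
    and "open V" and VU: "\<And>z t. z \<in> V \<Longrightarrow> 0 \<le> t \<Longrightarrow> t \<le> 1 \<Longrightarrow> z + t *\<^sub>R h \<in> U"
  shows "AE z in lborel. z \<in> V \<longrightarrow> g (z + h) = g z"
proof -
  have gm [measurable]: "g \<in> borel_measurable borel" by (rule locint_measurable[OF g])
  have "V \<subseteq> U" using VU[of _ 0] by auto
  have locG: "locint V (\<lambda>z. g (h + z))"
    unfolding locint_def
  proof safe
    fix K assume K: "compact K" "K \<subseteq> V"
    have "set_integrable lborel ((+) h ` K) g"
      using g compact_translation[OF K(1), of h] K(2) VU[of _ 1]
      by (auto simp: locint_def image_subset_iff subset_iff add.commute)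
    then have "integrable lborel (\<lambda>x. indicator ((+) h ` K) (h + 1 *\<^sub>R x) *\<^sub>R g (h + 1 *\<^sub>R x))"
      unfolding set_integrable_def by (intro lborel_integrable_isometry) auto
    moreover have "indicator ((+) h ` K) (h + x) = (indicator K x :: real)" for x
      by (auto simp: indicator_def)
    ultimately show "set_integrable lborel K (\<lambda>z. g (h + z))"
      by (simp add: set_integrable_def)
  qed measurable
  have "AE z in lborel. z \<in> V \<longrightarrow> g (h + z) - g z = 0"
  proof (rule fundamental_lemma[OF \<open>open V\<close>])
    show "locint V (\<lambda>z. g (h + z) - g z)"
      using locG locint_subset[OF g \<open>V \<subseteq> U\<close>] by (rule locint_diff)
    fix a assume a: "tfun V a"
    then obtain K where K: "K \<subseteq> V" "vanishes_off K a" by (auto simp: tfun_def)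
    \<comment> \<open>The set swept out by \<open>K\<close> along the segment: a single compact set
      containing the supports of all \<open>a' t\<close> with t in [0, 1].\<close>
    define K' where "K' = (\<lambda>(t, k). k + t *\<^sub>R h) ` ({0..1} \<times> K)"
    have "compact K'" unfolding K'_def using K
      by (intro compact_continuous_image compact_Times) (auto simp: vanishes_off_def case_prod_unfold intro!: continuous_intros)
    have "K' \<subseteq> U" using K VU by (auto simp: K'_def)
    have inK': "z \<in> K'" if "- (t *\<^sub>R h) + z \<in> K" "0 \<le> t" "t \<le> 1" for z t
      unfolding K'_def using that by (intro image_eqI[of _ _ "(t, - (t *\<^sub>R h) + z)"]) auto
    define a' where "a' t = compose_affine 1 (- (t *\<^sub>R h)) a" for t
    have ev_a': "ev (a' t) z = ev a (- (t *\<^sub>R h) + z)" "ev (pd h (a' t)) z = ev (pd h a) (- (t *\<^sub>R h) + z)" for t z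
      by (simp_all add: a'_def ev_affine ev_pd_affine)
    have tf: "tfun U (a' t)" if "0 \<le> t" "t \<le> 1" for t
      unfolding tfun_def vanishes_off_def
      using \<open>compact K'\<close> \<open>K' \<subseteq> U\<close> inK' K(2) that by (intro exI[of _ K']) (auto simp: ev_a' vanishes_off_def)
    obtain B where B: "\<And>x. \<bar>ev (pd h a) x\<bar> \<le> B"
      using ev_bounded[OF vanishes_off_pd[OF K(2)]] by metis
    have FTC: "(LINT t|lborel. indicator {0..1} t *\<^sub>R (- ev (pd h (a' t)) z)) = ev (a' 1) z - ev (a' 0) z" for z
    proof (rule integral_FTC_atLeastAtMost)
      have lin: "((\<lambda>t. - (t *\<^sub>R h) + z) has_derivative (\<lambda>t. - (t *\<^sub>R h))) (at t within {0..1})" for t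
        by (auto intro!: derivative_eq_intros)
      have "((\<lambda>t. ev a (- (t *\<^sub>R h) + z)) has_derivative (\<lambda>s. ev (pd (- (s *\<^sub>R h)) a) (- (t *\<^sub>R h) + z))) (at t within {0..1})" for t
        by (rule has_derivative_compose[OF lin ev_has_derivative])
      moreover have "ev (pd (- (s *\<^sub>R h)) a) x = - (s * ev (pd h a) x)" for s x
        using pd_scaleR[of "-s" h a x] by simp
      ultimately show "((\<lambda>t. ev (a' t) z) has_vector_derivative - ev (pd h (a' t)) z) (at t within {0..1})" for t
        by (simp add: has_vector_derivative_def ev_a')
      show "continuous_on {0..1} (\<lambda>t. - ev (pd h (a' t)) z)"
        unfolding ev_a' by (intro continuous_intros continuous_on_compose2[OF continuous_on_ev]) auto
    qed simp
    have int: "integrable (lborel \<Otimes>\<^sub>M lborel) (\<lambda>(t, z). (indicator {0..1} t * - ev (pd h (a' t)) z) * (1 * g z))"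
    proof -
      have "integrable (lborel \<Otimes>\<^sub>M lborel)
        (\<lambda>(t, z). (\<lambda>p. indicator {0..1} (fst p) * - ev (pd h a) (- (fst p *\<^sub>R h) + snd p)) (t, z) * (1 * g z))"
      proof (rule lborel_pair.integrable_kernel[where K="{0..1::real}" and L=K' and B=B])
        show "(\<lambda>p. indicator {0..1} (fst p) * - ev (pd h a) (- (fst p *\<^sub>R h) + snd p)) \<in> borel_measurable (lborel \<Otimes>\<^sub>M lborel)"
          by measurable
        have "B \<ge> 0" using B[of 0] by linarith
        then show "\<bar>indicator {0..1} (fst (x, y)) * - ev (pd h a) (- (fst (x, y) *\<^sub>R h) + snd (x, y))\<bar> \<le> B" for x y
          using B by (auto simp: indicator_def)
        show "indicator {0..1} (fst (x, y)) * - ev (pd h a) (- (fst (x, y) *\<^sub>R h) + snd (x, y)) = 0"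
          if "\<not> (x \<in> {0..1} \<and> y \<in> K')" for x y
          using that inK' vanishes_off_pd[OF K(2), of h] by (auto simp: vanishes_off_def indicator_def)
        show "set_integrable lborel K' g" using g \<open>compact K'\<close> \<open>K' \<subseteq> U\<close> by (auto simp: locint_def)
        show "set_integrable lborel {0..1} (\<lambda>x::real. 1::real)" by (simp add: set_integrable_def)
      qed auto
      then show ?thesis by (simp add: ev_a')
    qed
    have i1: "integrable lborel (\<lambda>z. ev (a' t) z * g z)" if "0 \<le> t" "t \<le> 1" for t
      using locint_tfun[OF g tf[OF that]] .
    have "(LINT z|lborel. ev a z * g (h + z)) = (LINT z|lborel. (\<lambda>z. ev (a' 1) z * g z) (h + 1 *\<^sub>R z))"
      by (simp add: ev_a')
    also have "\<dots> = (LINT z|lborel. ev (a' 1) z * g z)"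
      by (rule lborel_integral_isometry) (simp_all, measurable)
    finally have "(LINT z|lborel. ev a z * (g (h + z) - g z)) = (LINT z|lborel. ev (a' 1) z * g z) - (LINT z|lborel. ev (a' 0) z * g z)"
      using locint_tfun[OF locG a] locint_tfun[OF locint_subset[OF g \<open>V \<subseteq> U\<close>] a]
      by (simp add: right_diff_distrib ev_a')
    also have "\<dots> = (LINT z|lborel. (ev (a' 1) z - ev (a' 0) z) * g z)"
      using i1[of 0] i1[of 1] by (simp add: left_diff_distrib)
    also have "\<dots> = (LINT z|lborel. (LINT t|lborel. (indicator {0..1} t * - ev (pd h (a' t)) z) * (1 * g z)))"
      unfolding FTC[symmetric] by simp
    also have "\<dots> = (LINT t|lborel. (LINT z|lborel. (indicator {0..1} t * - ev (pd h (a' t)) z) * (1 * g z)))"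
      by (rule lborel_pair.Fubini_integral[OF int])
    also have "\<dots> = (LINT t|(lborel :: real measure). 0)"
    proof (rule Bochner_Integration.integral_cong[OF refl])
      fix t :: real
      show "(LINT z|lborel. (indicator {0..1} t * - ev (pd h (a' t)) z) * (1 * g z)) = 0"
        using zero[OF tf[of t]] by (cases "t \<in> {0..1}") auto
    qed
    finally show "(LINT z|lborel. ev a z * (g (h + z) - g z)) = 0" by simp
  qed
  then show ?thesis by eventually_elim (auto simp: add.commute)
qed

section \<open>Almost everywhere statements on products and on open sets\<close>

lemma AE_lborel_pair_fst:
  assumes "AE x in lborel. P (x::'a::euclidean_space)"
  shows "AE z in lborel. P (fst (z::'a \<times> 'b::euclidean_space))"
proof -
  obtain N where N: "{x. \<not> P x} \<subseteq> N" "N \<in> null_sets lborel"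
    using assms unfolding eventually_ae_filter by auto
  then have [measurable]: "N \<in> sets borel" by auto
  have "AE z in lborel \<Otimes>\<^sub>M lborel. fst (z::'a \<times> 'b) \<notin> N"
  proof (rule lborel_pair.AE_pair_measure)
    show "{z \<in> space (lborel \<Otimes>\<^sub>M lborel). fst (z::'a \<times> 'b) \<notin> N} \<in> sets (lborel \<Otimes>\<^sub>M lborel)"
      by measurable
  qed (use AE_not_in[OF N(2)] in auto)
  then show ?thesis unfolding lborel_prod by eventually_elim (use N(1) in auto)
qed

lemma AE_lborel_prod_swap:
  assumes "AE z in lborel. P (z::'a::euclidean_space \<times> 'b::euclidean_space)"
  shows "AE z in lborel. P (snd z, fst (z::'b \<times> 'a))"
proof -
  have "AE z in distr (lborel \<Otimes>\<^sub>M lborel) (lborel \<Otimes>\<^sub>M lborel) (\<lambda>(x, y). (y, x)). P z"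
    using assms unfolding lborel_pair.distr_pair_swap[symmetric] by (simp only: lborel_prod)
  then have "AE z in lborel \<Otimes>\<^sub>M lborel. P ((\<lambda>(x, y). (y, x)) (z::'b \<times> 'a))"
    by (rule AE_distrD[rotated]) simp
  then show ?thesis unfolding lborel_prod by (simp add: case_prod_unfold)
qed

lemma AE_lborel_ex_in_open:
  assumes "AE x in lborel. P (x::'a::euclidean_space)" "open W" "W \<noteq> {}"
  shows "\<exists>x\<in>W. P x"
proof (rule ccontr)
  assume "\<not> (\<exists>x\<in>W. P x)"
  then have "AE x in lebesgue. x \<in> W \<longrightarrow> x \<in> {}"
    using AE_completion[OF assms(1)] by auto
  then show False
    using mem_closed_if_AE_lebesgue_open[OF \<open>open W\<close>, of "{}"] \<open>W \<noteq> {}\<close> by auto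
qed

subsection \<open>Functions independent of one factor\<close>

lemma AE_lborel_pairD:
  assumes "AE z in lborel. P (z::'a::euclidean_space \<times> 'b::euclidean_space)"
  shows "AE x in lborel. AE y in lborel. P (x, y)"
  by (rule lborel_pair.AE_pair) (use assms in \<open>simp only: lborel_prod\<close>)

text \<open>Passing from sections back to the product is the direction of Fubini that takes a
  measurable condition, in contrast to \<open>AE_lborel_pairD\<close>.\<close>

lemma AE_lborel_pairI:
  assumes "{z. P z} \<in> sets borel" "AE x in lborel. AE y in lborel. P (x, y)"
  shows "AE z in lborel. P (z::'a::euclidean_space \<times> 'b::euclidean_space)"
proof -
  have "{z \<in> space (lborel \<Otimes>\<^sub>M lborel). P z} \<in> sets (lborel \<Otimes>\<^sub>M lborel)"
    unfolding lborel_prod using assms(1) by simp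
  from lborel_pair.AE_pair_measure[OF this assms(2)] show ?thesis
    by (simp only: lborel_prod)
qed

lemma fst_snd_borel_measurable:
  "(fst :: 'a::euclidean_space \<times> 'b::euclidean_space \<Rightarrow> 'a) \<in> borel_measurable borel"
  "(snd :: 'a \<times> 'b \<Rightarrow> 'b) \<in> borel_measurable borel"
  by (auto intro!: borel_measurable_continuous_onI continuous_intros)

lemma AE_lborel_commute:
  assumes "{z. P (fst z) (snd z)} \<in> sets (borel :: ('a::euclidean_space \<times> 'b::euclidean_space) measure)"
    and "AE x in lborel. AE y in lborel. P x y"
  shows "AE y in lborel. AE x in lborel. P x y"
proof -
  have "AE z in lborel. P (fst z) (snd z)"
    by (rule AE_lborel_pairI) (use assms in auto)
  from AE_lborel_pairD[OF AE_lborel_prod_swap[OF this]] show ?thesis by simp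
qed

text \<open>Each shift \<open>h\<close> has its own null set. Fubini exchanges the quantifiers and
  yields a level \<open>y\<^sub>0\<close> in \<open>B\<close> at which, for almost every x, the
  identity holds for almost every \<open>h\<close>. The slice of \<open>g\<close> at this level is
  \<open>\<alpha>\<close>.\<close>

lemma indep_of_snd_if_shift_invariant:
  fixes g :: "'a::euclidean_space \<times> 'b::euclidean_space \<Rightarrow> real"
  assumes g [measurable]: "g \<in> borel_measurable borel" and "open X" "open B" "B \<noteq> {}"
    and shift: "\<And>h. AE z in lborel. fst z \<in> X \<and> snd z \<in> B \<and> snd z + h \<in> B \<longrightarrow> g (fst z, snd z + h) = g z"
  obtains \<alpha> where "\<alpha> \<in> borel_measurable borel"
    "AE z in lborel. fst z \<in> X \<and> snd z \<in> B \<longrightarrow> g z = \<alpha> (fst z)"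
proof -
  note [measurable] = fst_snd_borel_measurable
  have [measurable]: "X \<in> sets borel" "B \<in> sets borel" using \<open>open X\<close> \<open>open B\<close> by auto
  define Q where "Q h z \<longleftrightarrow> (fst z \<in> X \<and> snd z \<in> B \<and> snd z + h \<in> B \<longrightarrow> g (fst z, snd z + h) = g z)" for h z
  have pair [measurable]: "(\<lambda>w. (fst (snd w), snd (snd w) + fst w)) \<in> borel_measurable (borel :: ('b \<times> 'a \<times> 'b) measure)"
    by (auto intro!: borel_measurable_continuous_onI continuous_intros)
  have "{w. Q (fst w) (snd w)} \<in> sets (borel :: ('b \<times> 'a \<times> 'b) measure)"
  proof -
    have "{w \<in> space (borel :: ('b \<times> 'a \<times> 'b) measure). Q (fst w) (snd w)} \<in> sets borel"
      unfolding Q_def by measurable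
    then show ?thesis by simp
  qed
  then have "AE z in lborel. AE h in lborel. Q h z"
    by (rule AE_lborel_commute) (use shift in \<open>simp add: Q_def\<close>)
  from AE_lborel_pairD[OF AE_lborel_prod_swap[OF this]]
  have "AE y in lborel. AE x in lborel. AE h in lborel. Q h (x, y)" by simp
  from AE_lborel_ex_in_open[OF this \<open>open B\<close> \<open>B \<noteq> {}\<close>]
  obtain y\<^sub>0 where y\<^sub>0: "y\<^sub>0 \<in> B" "AE x in lborel. AE h in lborel. Q h (x, y\<^sub>0)" by auto
  have [measurable]: "(\<lambda>x. (x, y\<^sub>0)) \<in> borel_measurable borel"
    by (auto intro!: borel_measurable_continuous_onI continuous_intros)
  have \<alpha> [measurable]: "(\<lambda>x. g (x, y\<^sub>0)) \<in> borel_measurable borel" by measurable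
  have "AE z in lborel. fst z \<in> X \<and> snd z \<in> B \<longrightarrow> g z = g (fst z, y\<^sub>0)"
  proof (rule AE_lborel_pairI)
    have "{z \<in> space borel. fst z \<in> X \<and> snd z \<in> B \<longrightarrow> g z = g (fst z, y\<^sub>0)} \<in> sets borel" by measurable
    then show "{z. fst z \<in> X \<and> snd z \<in> B \<longrightarrow> g z = g (fst z, y\<^sub>0)} \<in> sets borel" by simp
    show "AE x in lborel. AE y in lborel. fst (x, y) \<in> X \<and> snd (x, y) \<in> B \<longrightarrow> g (x, y) = g (fst (x, y), y\<^sub>0)"
      using y\<^sub>0(2)
    proof eventually_elim
      case (elim x)
      \<comment> \<open>The shift h = y - y0 turns almost every \<open>h\<close> into almost every
        y.\<close>
      have "AE y in lborel. Q (- y\<^sub>0 + 1 *\<^sub>R y) (x, y\<^sub>0)"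
        by (rule AE_lborel_isometry[OF _ elim]) simp
      then show ?case
        by eventually_elim (use y\<^sub>0(1) in \<open>auto simp: Q_def\<close>)
    qed
  qed
  with \<alpha> that show ?thesis by blast
qed

text \<open>A connectedness argument: \<open>S\<close> collects the points near which one fixed
  \<open>\<alpha>\<close> works, and a ball in \<open>Y\<close> that meets \<open>S\<close> must
  share this \<open>\<alpha>\<close>, so \<open>S\<close> is open and relatively closed. A countable
  subcover combines the local null sets. The shift hypothesis is confined to convex
  \<open>B\<close>, where segments stay inside; balls are such sets.\<close>

lemma indep_of_snd_on_product:
  fixes g :: "'a::euclidean_space \<times> 'b::euclidean_space \<Rightarrow> real"
  assumes g: "g \<in> borel_measurable borel" and X: "open X" and Y: "open Y" "connected Y"
    and shift: "\<And>B h. open B \<Longrightarrow> convex B \<Longrightarrow> B \<subseteq> Y \<Longrightarrow>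
      AE z in lborel. fst z \<in> X \<and> snd z \<in> B \<and> snd z + h \<in> B \<longrightarrow> g (fst z, snd z + h) = g z"
  obtains \<alpha> where "AE z in lborel. fst z \<in> X \<and> snd z \<in> Y \<longrightarrow> g z = \<alpha> (fst z)"
proof (cases "Y = {}")
  case True
  then show ?thesis using that[of "\<lambda>_. 0"] by simp
next
  case False
  define R where "R \<alpha> S \<longleftrightarrow> (AE z in lborel. fst z \<in> X \<and> snd z \<in> S \<longrightarrow> g z = \<alpha> (fst z))" for \<alpha> S
  have R_mono: "R \<alpha> S \<Longrightarrow> S' \<subseteq> S \<Longrightarrow> R \<alpha> S'" for \<alpha> S S'
    unfolding R_def by (erule eventually_mono) auto
  have loc: "\<exists>\<alpha>. R \<alpha> (ball y r)" if "ball y r \<subseteq> Y" "r > 0" for y r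
    using indep_of_snd_if_shift_invariant[OF g X open_ball, of y r] shift[OF open_ball convex_ball that(1)] that
    unfolding R_def by (metis ball_eq_empty not_less)
  obtain y\<^sub>0 where "y\<^sub>0 \<in> Y" using False by auto
  then obtain r\<^sub>0 where r\<^sub>0: "r\<^sub>0 > 0" "ball y\<^sub>0 r\<^sub>0 \<subseteq> Y" using Y(1) by (meson openE)
  then obtain \<alpha> where \<alpha>: "R \<alpha> (ball y\<^sub>0 r\<^sub>0)" using loc by blast
  define S where "S = {y. \<exists>r>0. ball y r \<subseteq> Y \<and> R \<alpha> (ball y r)}"
  define T where "T = {y. \<exists>r>0. ball y r \<inter> S = {}}"
  have "open S"
  proof (rule openI)
    fix y assume "y \<in> S"
    then obtain r where r: "r > 0" "ball y r \<subseteq> Y" "R \<alpha> (ball y r)" by (auto simp: S_def)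
    have "ball y r \<subseteq> S"
    proof
      fix y' assume "y' \<in> ball y r"
      then obtain e where "e > 0" "ball y' e \<subseteq> ball y r" using open_ball by (meson openE)
      with r R_mono show "y' \<in> S" unfolding S_def by blast
    qed
    with r show "\<exists>e>0. ball y e \<subseteq> S" by blast
  qed
  have "open T"
  proof (rule openI)
    fix y assume "y \<in> T"
    then obtain r where r: "r > 0" "ball y r \<inter> S = {}" by (auto simp: T_def)
    have "ball y r \<subseteq> T"
    proof
      fix y' assume "y' \<in> ball y r"
      then obtain e where "e > 0" "ball y' e \<subseteq> ball y r" using open_ball by (meson openE)
      with r show "y' \<in> T" unfolding T_def by blast
    qed
    with r show "\<exists>e>0. ball y e \<subseteq> T" by blast
  qed
  have "Y \<subseteq> S \<union> T"
  proof
    fix y assume "y \<in> Y"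
    then obtain r where r: "r > 0" "ball y r \<subseteq> Y" using Y(1) by (meson openE)
    show "y \<in> S \<union> T"
    proof (cases "ball y r \<inter> S = {}")
      case True
      then show ?thesis using r by (auto simp: T_def)
    next
      case False
      then obtain y' where y': "y' \<in> ball y r" "y' \<in> S" by auto
      then obtain r' where r': "r' > 0" "R \<alpha> (ball y' r')" by (auto simp: S_def)
      obtain \<beta> where \<beta>: "R \<beta> (ball y r)" using loc r by blast
      \<comment> \<open>On the overlap both functions represent \<open>g\<close>. A single good
        slice gives their equality for almost every x, since neither depends on the second
        variable.\<close>
      have "AE z in lborel. fst z \<in> X \<and> snd z \<in> ball y r \<inter> ball y' r' \<longrightarrow> \<beta> (fst z) = \<alpha> (fst z)"
        using \<beta> r'(2) unfolding R_def by eventually_elim auto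
      from AE_lborel_pairD[OF AE_lborel_prod_swap[OF this]]
      have "AE v in lborel. AE x in lborel. x \<in> X \<and> v \<in> ball y r \<inter> ball y' r' \<longrightarrow> \<beta> x = \<alpha> x" by simp
      moreover have "y' \<in> ball y r \<inter> ball y' r'" using y'(1) r'(1) by simp
      ultimately obtain v where "v \<in> ball y r \<inter> ball y' r'"
          "AE x in lborel. x \<in> X \<and> v \<in> ball y r \<inter> ball y' r' \<longrightarrow> \<beta> x = \<alpha> x"
        using AE_lborel_ex_in_open[of _ "ball y r \<inter> ball y' r'"] open_Int[OF open_ball open_ball] by blast
      then have "AE x in lborel. x \<in> X \<longrightarrow> \<beta> x = \<alpha> x" by simp
      then have "AE z in lborel. fst (z::'a \<times> 'b) \<in> X \<longrightarrow> \<beta> (fst z) = \<alpha> (fst z)"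
        by (rule AE_lborel_pair_fst)
      then have "R \<alpha> (ball y r)" using \<beta> unfolding R_def by eventually_elim auto
      then show ?thesis using r by (auto simp: S_def)
    qed
  qed
  moreover have "S \<inter> T \<inter> Y = {}" by (force simp: T_def)
  moreover have "y\<^sub>0 \<in> S \<inter> Y" using r\<^sub>0 \<alpha> \<open>y\<^sub>0 \<in> Y\<close> by (auto simp: S_def)
  ultimately have "T \<inter> Y = {}"
    using Y(2) \<open>open S\<close> \<open>open T\<close> unfolding connected_def by blast
  with \<open>Y \<subseteq> S \<union> T\<close> have "Y \<subseteq> S" by blast
  define F where "F = {U. open U \<and> R \<alpha> U}"
  have "Y \<subseteq> \<Union>F"
  proof
    fix y assume "y \<in> Y"
    with \<open>Y \<subseteq> S\<close> obtain r where "r > 0" "R \<alpha> (ball y r)" by (auto simp: S_def)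
    then show "y \<in> \<Union>F" by (auto simp: F_def intro!: exI[of _ "ball y r"])
  qed
  moreover obtain F' where F': "F' \<subseteq> F" "countable F'" "\<Union>F' = \<Union>F"
    using Lindelof[of F] by (auto simp: F_def)
  moreover have "AE z in lborel. \<forall>U\<in>F'. fst z \<in> X \<and> snd z \<in> U \<longrightarrow> g z = \<alpha> (fst z)"
    by (subst AE_ball_countable[OF F'(2)]) (use F'(1) in \<open>auto simp: F_def R_def\<close>)
  ultimately have "AE z in lborel. fst z \<in> X \<and> snd z \<in> Y \<longrightarrow> g z = \<alpha> (fst z)"
    by (elim eventually_mono) blast
  then show ?thesis by (rule that)
qed

lemma indep_of_snd:
  fixes g :: "'a::euclidean_space \<times> 'b::euclidean_space \<Rightarrow> real"
  assumes X: "open X" and Y: "open Y" "connected Y" and g: "locint (X \<times> Y) g"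
    and zero: "\<And>a h. tfun (X \<times> Y) a \<Longrightarrow> (LINT z|lborel. ev (pd (0, h) a) z * g z) = 0"
  obtains \<alpha> where "AE z in lborel. z \<in> X \<times> Y \<longrightarrow> g z = \<alpha> (fst z)"
proof (rule indep_of_snd_on_product[OF locint_measurable[OF g] X Y])
  fix B :: "'b set" and h assume B: "open B" "convex B" "B \<subseteq> Y"
  \<comment> \<open>These are the points whose second coordinate lies in \<open>B\<close> before and
    after the shift; convexity supplies the segment between.\<close>
  have "AE z in lborel. z \<in> X \<times> (B \<inter> (\<lambda>y. y + h) -` B) \<longrightarrow> g (z + (0, h)) = g z"
  proof (rule translation_invariance[OF open_Times[OF X Y(1)] g zero])
    show "open (X \<times> (B \<inter> (\<lambda>y. y + h) -` B))"
      using X B by (intro open_Times open_Int continuous_open_vimage continuous_intros) auto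
    fix z t assume "z \<in> X \<times> (B \<inter> (\<lambda>y. y + h) -` B)" "0 \<le> t" "t \<le> (1::real)"
    moreover from this have "(1 - t) *\<^sub>R snd z + t *\<^sub>R (snd z + h) \<in> B"
      using B(2) by (intro convexD) auto
    moreover have "(1 - t) *\<^sub>R snd z + t *\<^sub>R (snd z + h) = snd z + t *\<^sub>R h"
      by (simp add: algebra_simps)
    ultimately show "z + t *\<^sub>R (0, h) \<in> X \<times> Y" using B(3) by (cases z) auto
  qed
  then show "AE z in lborel. fst z \<in> X \<and> snd z \<in> B \<and> snd z + h \<in> B \<longrightarrow> g (fst z, snd z + h) = g z"
    by eventually_elim (auto simp: mem_Times_iff plus_prod_def)
qed (use that in \<open>simp add: mem_Times_iff\<close>)

text \<open>Only the almost everywhere identities are transported by the swap of factors. The test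
  expressions stay in the original coordinates and are never composed with it.\<close>

lemma indep_of_fst:
  fixes g :: "'a::euclidean_space \<times> 'b::euclidean_space \<Rightarrow> real"
  assumes X: "open X" "connected X" and Y: "open Y" and g: "locint (X \<times> Y) g"
    and zero: "\<And>a h. tfun (X \<times> Y) a \<Longrightarrow> (LINT z|lborel. ev (pd (h, 0) a) z * g z) = 0"
  obtains \<beta> where "AE z in lborel. z \<in> X \<times> Y \<longrightarrow> g z = \<beta> (snd z)"
proof (rule indep_of_snd_on_product[of "\<lambda>z. g (snd z, fst z)", OF _ Y X])
  have "(\<lambda>z::'b \<times> 'a. (snd z, fst z)) \<in> borel_measurable borel"
    by (auto intro!: borel_measurable_continuous_onI continuous_intros)
  then show "(\<lambda>z. g (snd z, fst z)) \<in> borel_measurable borel"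
    using locint_measurable[OF g] by (rule measurable_compose)
  fix B :: "'a set" and h assume B: "open B" "convex B" "B \<subseteq> X"
  have "AE z in lborel. z \<in> (B \<inter> (\<lambda>y. y + h) -` B) \<times> Y \<longrightarrow> g (z + (h, 0)) = g z"
  proof (rule translation_invariance[OF open_Times[OF X(1) Y] g zero])
    show "open ((B \<inter> (\<lambda>y. y + h) -` B) \<times> Y)"
      using Y B by (intro open_Times open_Int continuous_open_vimage continuous_intros) auto
    fix z t assume "z \<in> (B \<inter> (\<lambda>y. y + h) -` B) \<times> Y" "0 \<le> t" "t \<le> (1::real)"
    moreover from this have "(1 - t) *\<^sub>R fst z + t *\<^sub>R (fst z + h) \<in> B"
      using B(2) by (intro convexD) auto
    moreover have "(1 - t) *\<^sub>R fst z + t *\<^sub>R (fst z + h) = fst z + t *\<^sub>R h"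
      by (simp add: algebra_simps)
    ultimately show "z + t *\<^sub>R (h, 0) \<in> X \<times> Y" using B(3) by (cases z) auto
  qed
  from AE_lborel_prod_swap[OF this]
  show "AE z in lborel. fst z \<in> Y \<and> snd z \<in> B \<and> snd z + h \<in> B \<longrightarrow>
      g (snd (fst z, snd z + h), fst (fst z, snd z + h)) = g (snd z, fst z)"
    by eventually_elim (auto simp: mem_Times_iff plus_prod_def)
next
  fix \<beta> assume "AE z in lborel. fst z \<in> Y \<and> snd z \<in> X \<longrightarrow> g (snd z, fst z) = \<beta> (fst z)"
  from that[of \<beta>] AE_lborel_prod_swap[OF this] show thesis by (simp add: mem_Times_iff conj_commute)
qed

subsection \<open>Correlation of square-integrable functions\<close>

lemma continuous_approx_bounded:
  fixes g :: "'a::euclidean_space \<Rightarrow> real"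
  assumes g [measurable]: "g \<in> borel_measurable borel" and B: "\<And>x. \<bar>g x\<bar> \<le> B"
    and R: "\<And>x. norm x > R \<Longrightarrow> g x = 0" and "e > 0"
  obtains c M where "continuous_on UNIV c" "\<And>x. \<bar>c x\<bar> \<le> M"
    "integrable lborel (\<lambda>x. (g x - c x)\<^sup>2)" "(LINT x|lborel. (g x - c x)\<^sup>2) < e"
proof -
  \<comment> \<open>This notion of measurability provides continuous functions converging almost
    everywhere.\<close>
  have "g measurable_on UNIV"
    by (rule lebesgue_measurable_imp_measurable_on_real) (auto intro: measurable_completion)
  then obtain N c where N: "negligible N" and c: "\<And>n. continuous_on UNIV (c n)"
    and lim: "\<And>x. x \<notin> N \<Longrightarrow> (\<lambda>n. c n x) \<longlonglongrightarrow> g x"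
    unfolding measurable_on_def by auto
  have "B \<ge> 0" using B[of 0] by linarith
  \<comment> \<open>\<open>cut\<close> is 1 on the ball of radius \<open>R\<close> and 0 beyond
    radius \<open>R + 1\<close>. Clamping to [-B, B] and multiplying by it leave the limit
    \<open>g\<close> unchanged and give all approximants one integrable bound.\<close>
  define cut where "cut x = max 0 (min 1 (R + 1 - norm x))" for x :: 'a
  define d where "d n x = cut x * max (- B) (min B (c n x))" for n x
  have cont_d: "continuous_on UNIV (d n)" for n
    unfolding d_def cut_def by (intro continuous_intros c)
  have d_le: "\<bar>d n x\<bar> \<le> B * indicator (cball 0 (R + 1)) x" for n x
  proof -
    have "\<bar>d n x\<bar> \<le> cut x * B"
      using \<open>B \<ge> 0\<close> unfolding d_def abs_mult by (intro mult_mono) (auto simp: cut_def)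
    also have "\<dots> \<le> B * indicator (cball 0 (R + 1)) x"
      using \<open>B \<ge> 0\<close> by (cases "x \<in> cball 0 (R + 1)") (auto simp: cut_def intro!: mult_left_le_one_le)
    finally show ?thesis .
  qed
  have g_le: "\<bar>g x\<bar> \<le> B * indicator (cball 0 (R + 1)) x" for x
    using B[of x] R[of x] by (auto simp: indicator_def)
  have bound: "(g x - d n x)\<^sup>2 \<le> (2 * B)\<^sup>2 * indicator (cball 0 (R + 1)) x" for n x
  proof -
    have "\<bar>g x - d n x\<bar> \<le> 2 * B * indicator (cball 0 (R + 1)) x"
      using d_le[of n x] g_le[of x] by linarith
    then have "\<bar>g x - d n x\<bar>\<^sup>2 \<le> (2 * B * indicator (cball 0 (R + 1)) x)\<^sup>2"
      by (rule power_mono) simp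
    then show ?thesis
      by (cases "x \<in> cball 0 (R + 1)") (auto simp: power_mult_distrib)
  qed
  have [measurable]: "d n \<in> borel_measurable borel" for n
    using cont_d by (intro borel_measurable_continuous_onI)
  have w: "integrable lborel (\<lambda>x::'a. (2 * B)\<^sup>2 * indicator (cball 0 (R + 1)) x)"
    by (intro integrable_mult_right integrable_real_indicator) (use emeasure_bounded_finite[OF bounded_cball] in auto)
  have "AE x in lborel. x \<notin> N"
  proof -
    have "AE x in lebesgue. x \<notin> N"
      using N by (intro AE_not_in) (simp add: negligible_iff_null_sets)
    then show ?thesis by (simp add: AE_completion_iff)
  qed
  then have "AE x in lborel. (\<lambda>n. (g x - d n x)\<^sup>2) \<longlonglongrightarrow> 0"
  proof eventually_elim
    case (elim x)
    have "(\<lambda>n. (g x - d n x)\<^sup>2) \<longlonglongrightarrow> (g x - cut x * max (- B) (min B (g x)))\<^sup>2"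
      unfolding d_def by (intro tendsto_intros lim elim)
    moreover have "max (- B) (min B (g x)) = g x" using B[of x] by linarith
    moreover have "cut x * g x = g x"
      using R[of x] by (cases "norm x > R") (auto simp: cut_def)
    ultimately show ?case by simp
  qed
  then have "(\<lambda>n. LINT x|lborel. (g x - d n x)\<^sup>2) \<longlonglongrightarrow> (LINT x|(lborel :: 'a measure). 0)"
    by (intro integral_dominated_convergence[OF _ _ w]) (use bound in auto)
  then have "(\<lambda>n. LINT x|lborel. (g x - d n x)\<^sup>2) \<longlonglongrightarrow> 0" by simp
  from order_tendstoD(2)[OF this \<open>e > 0\<close>]
  obtain n where n: "(LINT x|lborel. (g x - d n x)\<^sup>2) < e"
    by (auto simp: eventually_sequentially)
  show ?thesis
  proof (rule that[OF cont_d _ _ n])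
    show "\<bar>d n x\<bar> \<le> B" for x using d_le[of n x] \<open>B \<ge> 0\<close>
      by (cases "x \<in> cball 0 (R + 1)") auto
    show "integrable lborel (\<lambda>x. (g x - d n x)\<^sup>2)"
      by (rule Bochner_Integration.integrable_bound[OF w]) (use bound in auto)
  qed
qed

lemma square_add_le: "((a::real) + b)\<^sup>2 \<le> 2 * a\<^sup>2 + 2 * b\<^sup>2"
  using sum_squares_bound[of a b] by (simp add: power2_sum)

text \<open>Truncating both values and domain at \<open>n\<close> reduces to the bounded case; the
  truncation error is dominated by the square of \<open>g\<close>.\<close>

lemma continuous_approx_L2:
  fixes g :: "'a::euclidean_space \<Rightarrow> real"
  assumes g [measurable]: "g \<in> borel_measurable borel" and g2: "integrable lborel (\<lambda>x. (g x)\<^sup>2)" and "e > 0"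
  obtains c M where "continuous_on UNIV c" "\<And>x. \<bar>c x\<bar> \<le> M"
    "integrable lborel (\<lambda>x. (g x - c x)\<^sup>2)" "(LINT x|lborel. (g x - c x)\<^sup>2) < e"
proof -
  define t where "t n x = indicator (cball 0 (real n)) x * max (- real n) (min (real n) (g x))" for n x
  have [measurable]: "t n \<in> borel_measurable borel" for n
    unfolding t_def
    by (intro borel_measurable_times borel_measurable_indicator borel_measurable_max borel_measurable_min
        borel_measurable_const g) auto
  have bound: "(g x - t n x)\<^sup>2 \<le> (g x)\<^sup>2" for n x
    unfolding abs_le_square_iff[symmetric] t_def by (auto simp: indicator_def abs_if max_def min_def)
  have "(\<lambda>n. LINT x|lborel. (g x - t n x)\<^sup>2) \<longlonglongrightarrow> (LINT x|(lborel :: 'a measure). 0)"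
  proof (rule integral_dominated_convergence[OF _ _ g2])
    show "AE x in lborel. (\<lambda>n. (g x - t n x)\<^sup>2) \<longlonglongrightarrow> 0"
    proof (intro always_eventually allI)
      fix x
      obtain m where m: "max (norm x) \<bar>g x\<bar> < real m" using reals_Archimedean2 by blast
      have "(g x - t n x)\<^sup>2 = 0" if "n \<ge> m" for n
      proof -
        have "norm x < real n" "\<bar>g x\<bar> < real n" using m that by auto
        then show ?thesis by (simp add: t_def min_absorb2 max_absorb2 abs_less_iff)
      qed
      then show "(\<lambda>n. (g x - t n x)\<^sup>2) \<longlonglongrightarrow> 0"
        by (intro tendsto_eventually) (auto simp: eventually_sequentially)
    qed
  qed (use bound in auto)
  then have "(\<lambda>n. LINT x|lborel. (g x - t n x)\<^sup>2) \<longlonglongrightarrow> 0" by simp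
  \<comment> \<open>Two errors below e/4, each doubled by \<open>square_add_le\<close>, add up to
    less than e.\<close>
  moreover have "e / 4 > 0" using \<open>e > 0\<close> by simp
  ultimately have "\<forall>\<^sub>F n in sequentially. (LINT x|lborel. (g x - t n x)\<^sup>2) < e / 4"
    by (rule order_tendstoD(2))
  then obtain n where n: "(LINT x|lborel. (g x - t n x)\<^sup>2) < e / 4"
    by (auto simp: eventually_sequentially)
  have int_t: "integrable lborel (\<lambda>x. (g x - t n x)\<^sup>2)"
    by (rule Bochner_Integration.integrable_bound[OF g2]) (use bound in auto)
  obtain c M where c: "continuous_on UNIV c" "\<And>x. \<bar>c x\<bar> \<le> M"
    "integrable lborel (\<lambda>x. (t n x - c x)\<^sup>2)" "(LINT x|lborel. (t n x - c x)\<^sup>2) < e / 4"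
  proof (rule continuous_approx_bounded[of "t n" "real n" "real n" "e / 4"])
    show "\<bar>t n x\<bar> \<le> real n" for x by (auto simp: t_def indicator_def)
    show "t n x = 0" if "norm x > real n" for x using that by (auto simp: t_def)
  qed (use \<open>e > 0\<close> in auto)
  have [measurable]: "c \<in> borel_measurable borel"
    using c(1) by (rule borel_measurable_continuous_onI)
  have le: "(g x - c x)\<^sup>2 \<le> 2 * (g x - t n x)\<^sup>2 + 2 * (t n x - c x)\<^sup>2" for x
    using square_add_le[of "g x - t n x" "t n x - c x"] by simp
  have int: "integrable lborel (\<lambda>x. 2 * (g x - t n x)\<^sup>2 + 2 * (t n x - c x)\<^sup>2)"
    using int_t c(3) by simp
  have int': "integrable lborel (\<lambda>x. (g x - c x)\<^sup>2)"
    by (rule Bochner_Integration.integrable_bound[OF int]) (use le in auto)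
  have "(LINT x|lborel. (g x - c x)\<^sup>2) \<le> (LINT x|lborel. 2 * (g x - t n x)\<^sup>2 + 2 * (t n x - c x)\<^sup>2)"
    by (rule integral_mono[OF int' int le])
  also have "\<dots> < e" using int_t c(3,4) n by simp
  finally show ?thesis using that[OF c(1,2) int'] by blast
qed

section \<open>Products of square-integrable functions and continuity of the correlation\<close>

lemma mult_le_weighted_squares:
  fixes a b t :: real
  assumes "t > 0" shows "\<bar>a * b\<bar> \<le> t / 2 * a\<^sup>2 + 1 / (2 * t) * b\<^sup>2"
proof -
  have "0 \<le> (t * \<bar>a\<bar> - \<bar>b\<bar>)\<^sup>2 / (2 * t)" using assms by simp
  also have "\<dots> = t / 2 * a\<^sup>2 + 1 / (2 * t) * b\<^sup>2 - \<bar>a * b\<bar>"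
    using assms by (simp add: power2_diff power_mult_distrib field_simps abs_mult power2_eq_square)
  finally show ?thesis by simp
qed

text \<open>Young's inequality, integrated, in the place of Cauchy-Schwarz: a small weight
  \<open>t\<close> makes the term of a fixed \<open>a\<close> small, provided \<open>b\<close> is
  small enough compared with \<open>t\<close>.\<close>

lemma integrable_mult_L2:
  fixes a b :: "'a \<Rightarrow> real"
  assumes [measurable]: "a \<in> borel_measurable M" "b \<in> borel_measurable M"
    and a: "integrable M (\<lambda>x. (a x)\<^sup>2)" and b: "integrable M (\<lambda>x. (b x)\<^sup>2)"
  shows "integrable M (\<lambda>x. a x * b x)"
    and "t > 0 \<Longrightarrow> \<bar>LINT x|M. a x * b x\<bar> \<le> t / 2 * (LINT x|M. (a x)\<^sup>2) + 1 / (2 * t) * (LINT x|M. (b x)\<^sup>2)"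
proof -
  have int: "integrable M (\<lambda>x. t / 2 * (a x)\<^sup>2 + 1 / (2 * t) * (b x)\<^sup>2)" for t
    using a b by simp
  show ab: "integrable M (\<lambda>x. a x * b x)"
    by (rule Bochner_Integration.integrable_bound[OF int[of 1]])
      (use mult_le_weighted_squares[of 1] in \<open>auto intro!: always_eventually order_trans[OF _ abs_ge_self]\<close>)
  assume "t > 0"
  have "\<bar>LINT x|M. a x * b x\<bar> \<le> (LINT x|M. \<bar>a x * b x\<bar>)" by (rule integral_abs_bound)
  also have "\<dots> \<le> (LINT x|M. t / 2 * (a x)\<^sup>2 + 1 / (2 * t) * (b x)\<^sup>2)"
    by (intro integral_mono int mult_le_weighted_squares \<open>t > 0\<close> integrable_abs ab)
  also have "\<dots> = t / 2 * (LINT x|M. (a x)\<^sup>2) + 1 / (2 * t) * (LINT x|M. (b x)\<^sup>2)"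
    using a b by simp
  finally show "\<bar>LINT x|M. a x * b x\<bar> \<le> t / 2 * (LINT x|M. (a x)\<^sup>2) + 1 / (2 * t) * (LINT x|M. (b x)\<^sup>2)" .
qed

text \<open>At z = 0 this is the integral of the product \<open>a * b\<close>; for other z the
  second factor is translated.\<close>

definition corr :: "('a::euclidean_space \<Rightarrow> real) \<Rightarrow> ('a \<Rightarrow> real) \<Rightarrow> 'a \<Rightarrow> real"
  where "corr a b z = (LINT x|lborel. a x * b (x - z))"

lemma L2_shift:
  fixes b :: "'a::euclidean_space \<Rightarrow> real"
  assumes b [measurable]: "b \<in> borel_measurable borel" and b2: "integrable lborel (\<lambda>x. (b x)\<^sup>2)"
  shows "integrable lborel (\<lambda>x. (b (x - z))\<^sup>2)" "(LINT x|lborel. (b (x - z))\<^sup>2) = (LINT x|lborel. (b x)\<^sup>2)"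
  using lborel_integrable_isometry[OF _ b2, of 1 "- z"] lborel_integral_isometry[of 1 "\<lambda>x. (b x)\<^sup>2" "- z"]
  by auto

text \<open>Replacing \<open>b\<close> by a bounded continuous \<open>c\<close> close to it in L^2
  costs an error uniform in z, because translations preserve the L^2 norm. For \<open>c\<close> the
  continuity is dominated convergence, with the bound \<open>M * \<bar>a x\<bar>\<close>; this is
  where \<open>a\<close> must be integrable.\<close>

lemma isCont_corr:
  fixes a b :: "'a::euclidean_space \<Rightarrow> real"
  assumes a: "integrable lborel a" and a2: "integrable lborel (\<lambda>x. (a x)\<^sup>2)"
    and b [measurable]: "b \<in> borel_measurable borel" and b2: "integrable lborel (\<lambda>x. (b x)\<^sup>2)"
  shows "isCont (corr a b) 0"
  unfolding continuous_at_sequentially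
proof (intro allI impI)
  fix Z :: "nat \<Rightarrow> 'a" assume Z: "Z \<longlonglongrightarrow> 0"
  have am [measurable]: "a \<in> borel_measurable borel" using borel_measurable_integrable[OF a] by simp
  show "(corr a b \<circ> Z) \<longlonglongrightarrow> corr a b 0"
  proof (rule LIMSEQ_I)
    fix r :: real assume "r > 0"
    define A where "A = (LINT x|lborel. (a x)\<^sup>2)"
    have "A \<ge> 0" unfolding A_def by simp
    \<comment> \<open>With this \<open>t\<close> the first Young term is at most r/6, and an L^2
      error below t r / 3 makes the second one less than r/6. The summand 1 prevents division by
      zero when \<open>A = 0\<close>.\<close>
    define t where "t = r / (3 * (A + 1))"
    have "t > 0" using \<open>r > 0\<close> \<open>A \<ge> 0\<close> by (simp add: t_def)
    have tA: "t / 2 * A \<le> r / 6"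
      using \<open>r > 0\<close> \<open>A \<ge> 0\<close> by (simp add: t_def field_simps)
    obtain c M where c: "continuous_on UNIV c" "\<And>x. \<bar>c x\<bar> \<le> M"
      "integrable lborel (\<lambda>x. (b x - c x)\<^sup>2)" "(LINT x|lborel. (b x - c x)\<^sup>2) < t * r / 3"
      using continuous_approx_L2[OF b b2, of "t * r / 3"] \<open>t > 0\<close> \<open>r > 0\<close> by auto
    have cm [measurable]: "c \<in> borel_measurable borel"
      using c(1) by (rule borel_measurable_continuous_onI)
    have ab: "integrable lborel (\<lambda>x. a x * b (x - z))" for z
      by (rule integrable_mult_L2) (use a2 L2_shift[OF b b2] in auto)
    have w: "integrable lborel (\<lambda>x. M * \<bar>a x\<bar>)" using a by simp
    have ac_le: "\<bar>a x * c (x - z)\<bar> \<le> M * \<bar>a x\<bar>" for x z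
      using c(2)[of "x - z"] by (subst mult.commute) (simp add: abs_mult mult_right_mono)
    have ac: "integrable lborel (\<lambda>x. a x * c (x - z))" for z
      by (rule Bochner_Integration.integrable_bound[OF w])
        (use ac_le in \<open>auto intro!: always_eventually order_trans[OF _ abs_ge_self]\<close>)
    have close: "\<bar>corr a b z - corr a c z\<bar> < r / 3" for z
    proof -
      have "corr a b z - corr a c z = (LINT x|lborel. a x * (b (x - z) - c (x - z)))"
        unfolding corr_def right_diff_distrib using ab ac by simp
      moreover have "\<bar>\<dots>\<bar> \<le> t / 2 * A + 1 / (2 * t) * (LINT x|lborel. (b (x - z) - c (x - z))\<^sup>2)"
        unfolding A_def using L2_shift[of "\<lambda>x. b x - c x" z] c(3) a2 \<open>t > 0\<close>
        by (intro integrable_mult_L2) auto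
      moreover have "1 / (2 * t) * (LINT x|lborel. (b (x - z) - c (x - z))\<^sup>2) < r / 6"
        using L2_shift(2)[of "\<lambda>x. b x - c x" z] c(3,4) \<open>t > 0\<close> by (simp add: field_simps)
      ultimately show ?thesis using tA by linarith
    qed
    have "(\<lambda>n. corr a c (Z n)) \<longlonglongrightarrow> corr a c 0"
      unfolding corr_def
    proof (rule integral_dominated_convergence[OF _ _ w])
      show "AE x in lborel. (\<lambda>n. a x * c (x - Z n)) \<longlonglongrightarrow> a x * c (x - 0)"
      proof (intro always_eventually allI tendsto_mult tendsto_const)
        fix x
        have "(\<lambda>n. x - Z n) \<longlonglongrightarrow> x - 0" by (intro tendsto_intros Z)
        then show "(\<lambda>n. c (x - Z n)) \<longlonglongrightarrow> c (x - 0)"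
          using c(1) by (intro isCont_tendsto_compose[of _ c]) (auto simp: continuous_on_eq_continuous_at)
      qed
    qed (use ac_le in auto)
    then obtain n\<^sub>0 where "\<And>n. n \<ge> n\<^sub>0 \<Longrightarrow> \<bar>corr a c (Z n) - corr a c 0\<bar> < r / 3"
      using LIMSEQ_D[of "\<lambda>n. corr a c (Z n)" "corr a c 0" "r / 3"] \<open>r > 0\<close> by (metis real_norm_def divide_pos_pos zero_less_numeral)
    then show "\<exists>n\<^sub>0. \<forall>n\<ge>n\<^sub>0. norm ((corr a b \<circ> Z) n - corr a b 0) < r"
    proof (intro exI[of _ n\<^sub>0] allI impI)
      fix n assume "n \<ge> n\<^sub>0"
      then have "\<bar>corr a c (Z n) - corr a c 0\<bar> < r / 3" by fact
      with close[of 0] close[of "Z n"] show "norm ((corr a b \<circ> Z) n - corr a b 0) < r"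
        unfolding comp_apply real_norm_def by linarith
    qed
  qed
qed

lemma corr_measurable_bounded:
  fixes a b :: "'a::euclidean_space \<Rightarrow> real"
  assumes a [measurable]: "a \<in> borel_measurable borel" and a2: "integrable lborel (\<lambda>x. (a x)\<^sup>2)"
    and b [measurable]: "b \<in> borel_measurable borel" and b2: "integrable lborel (\<lambda>x. (b x)\<^sup>2)"
  shows "locint UNIV (corr a b)"
proof -
  have [measurable]: "corr a b \<in> borel_measurable borel"
    unfolding corr_def[abs_def] by measurable
  define B where "B = 1 / 2 * (LINT x|lborel. (a x)\<^sup>2) + 1 / 2 * (LINT x|lborel. (b x)\<^sup>2)"
  have B: "\<bar>corr a b z\<bar> \<le> B" for z
    using integrable_mult_L2(2)[of a lborel "\<lambda>x. b (x - z)" 1] L2_shift[OF b b2, of z] a2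
    by (simp add: corr_def B_def)
  have "set_integrable lborel K (corr a b)" if "compact K" for K
    unfolding set_integrable_def
  proof (rule Bochner_Integration.integrable_bound)
    show "integrable lborel (\<lambda>x. B * indicator K x)"
      using that by (intro integrable_mult_right integrable_real_indicator)
        (use emeasure_bounded_finite[OF compact_imp_bounded[OF that]] borel_compact[OF that] in auto)
    show "(\<lambda>x. indicat_real K x *\<^sub>R corr a b x) \<in> borel_measurable lborel"
      using borel_compact[OF that] by measurable
    show "AE x in lborel. norm (indicat_real K x *\<^sub>R corr a b x) \<le> norm (B * indicat_real K x)"
      using B by (auto simp: indicator_def intro!: order_trans[OF _ abs_ge_self])
  qed
  then show ?thesis by (simp add: locint_def)
qed

text \<open>For fixed x the substitution y = x - z is an isometry, so the shear is handled slice by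
  slice and Fubini assembles the slices.\<close>

lemma lborel_shear:
  fixes F :: "'a::euclidean_space \<Rightarrow> 'a \<Rightarrow> real"
  assumes F: "integrable (lborel \<Otimes>\<^sub>M lborel) (case_prod F)"
  shows "integrable lborel (\<lambda>z. LINT x|lborel. F x (x - z))"
    and "(LINT z|lborel. LINT x|lborel. F x (x - z)) = (LINT x|lborel. LINT y|lborel. F x y)"
proof -
  have Fm: "case_prod F \<in> borel_measurable (borel \<Otimes>\<^sub>M borel)"
    using borel_measurable_integrable[OF F] by (simp cong: measurable_cong_sets)
  have Fx: "F x \<in> borel_measurable borel" for x
    using measurable_compose[OF measurable_Pair1' Fm, of x] by simp
  have refl: "(LINT z|lborel. f (x - z)) = (LINT y|lborel. f y)" if "f \<in> borel_measurable borel" for f :: "'a \<Rightarrow> real" and x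
    using lborel_integral_isometry[of "-1" f x] that by simp
  have "integrable (lborel \<Otimes>\<^sub>M lborel) (\<lambda>(x, z). F x (x - z))"
  proof (rule lborel_pair.Fubini_integrable)
    have "(\<lambda>(x, z). case_prod F (x, x - z)) \<in> borel_measurable (borel \<Otimes>\<^sub>M borel)"
      using Fm by measurable
    then show "(\<lambda>(x, z). F x (x - z)) \<in> borel_measurable (lborel \<Otimes>\<^sub>M lborel)"
      by (simp cong: measurable_cong_sets)
    have "integrable lborel (\<lambda>x. LINT y|lborel. norm (F x y))"
      using lborel_pair.integrable_fst[of "\<lambda>x y. norm (F x y)"] integrable_norm[OF F]
      by (simp add: case_prod_unfold)
    moreover have "(LINT z|lborel. norm (F x (x - z))) = (LINT y|lborel. norm (F x y))" for x
      using refl[of "\<lambda>y. norm (F x y)" x] Fx by simp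
    ultimately show "integrable lborel (\<lambda>x. LINT z|lborel. norm (case (x, z) of (x, z) \<Rightarrow> F x (x - z)))"
      by simp
    have "AE x in lborel. integrable lborel (F x)" by (rule lborel_pair.AE_integrable_fst[OF F])
    then show "AE x in lborel. integrable lborel (\<lambda>z. case (x, z) of (x, z) \<Rightarrow> F x (x - z))"
    proof eventually_elim
      case (elim x)
      then show ?case using lborel_integrable_isometry[of "-1" "F x" x] by simp
    qed
  qed
  then have G: "integrable (lborel \<Otimes>\<^sub>M lborel) (case_prod (\<lambda>x z. F x (x - z)))" by simp
  show "integrable lborel (\<lambda>z. LINT x|lborel. F x (x - z))"
    by (rule lborel_pair.integrable_snd[OF G])
  have "(LINT z|lborel. LINT x|lborel. F x (x - z)) = (LINT x|lborel. LINT z|lborel. F x (x - z))"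
    by (rule lborel_pair.Fubini_integral[OF G])
  then show "(LINT z|lborel. LINT x|lborel. F x (x - z)) = (LINT x|lborel. LINT y|lborel. F x y)"
    by (simp add: refl[OF Fx])
qed

subsection \<open>Closedness of the two-forms\<close>

text \<open>The derivative in each direction is a function of its own, fixed everywhere as a Borel
  representative; exceptional null sets may therefore depend on the direction.\<close>

definition weak_grad :: "'a::euclidean_space set \<Rightarrow> ('a \<Rightarrow> real) \<Rightarrow> ('a \<Rightarrow> 'a \<Rightarrow> real) \<Rightarrow> bool"
  where "weak_grad U u G \<longleftrightarrow> locint U u \<and>
    (\<forall>v. locint U (G v) \<and> locint U (\<lambda>x. (G v x)\<^sup>2) \<and>
      (\<forall>a. tfun U a \<longrightarrow> (LINT x|lborel. ev a x * G v x) = - (LINT x|lborel. ev (pd v a) x * u x)))"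

lemma kernel_integrable:
  fixes f g :: "'a::euclidean_space \<Rightarrow> real"
  assumes "locint U f" "locint U g" and K: "vanishes_off K \<phi>" "K \<subseteq> U" and K': "compact K'" "K' \<subseteq> U"
    and inK': "\<And>x z. x \<in> K \<Longrightarrow> z \<in> L \<Longrightarrow> x - z \<in> K'" and \<rho>: "vanishes_off L \<rho>"
  shows "integrable (lborel \<Otimes>\<^sub>M lborel) (\<lambda>(x, y). ev \<rho> (x - y) * ev \<phi> x * (f x * g y))"
proof -
  obtain B where B: "\<And>x. \<bar>ev \<rho> x\<bar> \<le> B" using ev_bounded[OF \<rho>] by metis
  obtain B' where B': "\<And>x. \<bar>ev \<phi> x\<bar> \<le> B'" using ev_bounded[OF K(1)] by metis
  have "integrable (lborel \<Otimes>\<^sub>M lborel)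
    (\<lambda>(x, y). (\<lambda>p. ev \<rho> (fst p - snd p) * ev \<phi> (fst p)) (x, y) * (f x * g y))"
  proof (rule lborel_pair.integrable_kernel[where K=K and L=K' and B="B * B'"])
    show "(\<lambda>p. ev \<rho> (fst p - snd p) * ev \<phi> (fst p)) \<in> borel_measurable (lborel \<Otimes>\<^sub>M lborel)"
      by measurable
    have "B \<ge> 0" using B[of 0] by linarith
    then show "\<bar>ev \<rho> (fst (x, y) - snd (x, y)) * ev \<phi> (fst (x, y))\<bar> \<le> B * B'" for x y
      unfolding abs_mult using B B' by (intro mult_mono) auto
    show "ev \<rho> (fst (x, y) - snd (x, y)) * ev \<phi> (fst (x, y)) = 0" if "\<not> (x \<in> K \<and> y \<in> K')" for x y
      using that inK'[of x "x - y"] K(1) \<rho> by (auto simp: vanishes_off_def)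
    have "compact K" using K(1) by (simp add: vanishes_off_def)
    then show "set_integrable lborel K f" "set_integrable lborel K' g"
      using assms by (auto simp: locint_def)
  qed (use assms locint_measurable in auto)
  then show ?thesis by simp
qed

text \<open>Mollification in disguise: integrating the correlation against \<open>\<rho>\<close> allows the weak derivatives
  \<open>G q\<close> and \<open>H r\<close> to be moved onto \<open>\<rho>\<close> and \<open>\<phi>\<close>. In the alternating sum over \<open>p\<close>, \<open>q\<close>, \<open>r\<close> the terms
  \<open>S\<close> then cancel because second derivatives are symmetric. The value of the correlation at 0,
  which is the integral of interest, is recovered by continuity.\<close>

lemma corr_against_bump:
  fixes u w :: "'a::euclidean_space \<Rightarrow> real" and p q r :: 'a
  assumes G: "weak_grad U u G" and H: "weak_grad U w H"
    and K: "vanishes_off K \<phi>" "K \<subseteq> U" and K': "compact K'" "K' \<subseteq> U"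
    and inK': "\<And>x z. x \<in> K \<Longrightarrow> z \<in> W \<Longrightarrow> x - z \<in> K'" and \<rho>: "tfun W \<rho>"
  defines "C \<equiv> corr (\<lambda>x. ev (pd p \<phi>) x * H r x) (\<lambda>y. indicator K' y * G q y)"
    and "S \<equiv> \<lambda>y x. ev (pd r (pd q \<rho>)) (x - y) * ev (pd p \<phi>) x + ev (pd q \<rho>) (x - y) * ev (pd r (pd p \<phi>)) x"
  shows "integrable lborel (\<lambda>z. ev \<rho> z * C z)"
    and "integrable lborel (\<lambda>y. indicator K' y * u y * (LINT x|lborel. S y x * w x))"
    and "(LINT z|lborel. ev \<rho> z * C z) = - (LINT y|lborel. indicator K' y * u y * (LINT x|lborel. S y x * w x))"
    and "\<And>y. integrable lborel (\<lambda>x. S y x * w x)"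
proof -
  obtain L where L: "L \<subseteq> W" "vanishes_off L \<rho>" using \<rho> by (auto simp: tfun_def)
  have inK'': "x - z \<in> K'" if "x \<in> K" "z \<in> L" for x z using inK' L that by auto
  have Gq: "locint U (G q)" "\<And>a. tfun U a \<Longrightarrow> (LINT x|lborel. ev a x * G q x) = - (LINT x|lborel. ev (pd q a) x * u x)"
    and u: "locint U u" using G by (auto simp: weak_grad_def)
  have Hr: "locint U (H r)" "\<And>a. tfun U a \<Longrightarrow> (LINT x|lborel. ev a x * H r x) = - (LINT x|lborel. ev (pd r a) x * w x)"
    and w: "locint U w" using H by (auto simp: weak_grad_def)
  note \<phi>p = vanishes_off_pd[OF K(1), of p]
  have out\<phi>: "x \<notin> K \<Longrightarrow> ev (pd p \<phi>) x = 0" for x using \<phi>p by (simp add: vanishes_off_def)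
  have out\<rho>: "z \<notin> L \<Longrightarrow> ev \<rho> z = 0" "z \<notin> L \<Longrightarrow> ev (pd q \<rho>) z = 0" for z
    using L(2) vanishes_off_pd[OF L(2), of q] by (auto simp: vanishes_off_def)
  \<comment> \<open>\<open>F\<close> is the integrand of the correlation after y = x - z;
    \<open>F'\<close> below is what remains once the derivative in direction \<open>q\<close> has
    moved from \<open>u\<close> to \<open>\<rho>\<close>.\<close>
  define F where "F x y = ev \<rho> (x - y) * ev (pd p \<phi>) x * (H r x * G q y)" for x y
  have intF: "integrable (lborel \<Otimes>\<^sub>M lborel) (case_prod F)"
    unfolding F_def by (rule kernel_integrable[OF Hr(1) Gq(1) \<phi>p K(2) K' inK'' L(2)])
  define F' where "F' x y = ev (pd q \<rho>) (x - y) * ev (pd p \<phi>) x * (H r x * u y)" for x y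
  have intF': "integrable (lborel \<Otimes>\<^sub>M lborel) (case_prod F')"
    unfolding F'_def by (rule kernel_integrable[OF Hr(1) u \<phi>p K(2) K' inK'' vanishes_off_pd[OF L(2)]])
  have C: "ev \<rho> z * C z = (LINT x|lborel. F x (x - z))" for z
  proof -
    have "F x (x - z) = ev \<rho> z * (ev (pd p \<phi>) x * H r x * (indicator K' (x - z) * G q (x - z)))" for x
      using inK''[of x z] out\<phi>[of x] out\<rho>[of z] by (cases "x \<in> K"; cases "z \<in> L") (auto simp: F_def)
    then show ?thesis by (simp add: C_def corr_def)
  qed
  show "integrable lborel (\<lambda>z. ev \<rho> z * C z)"
    unfolding C by (rule lborel_shear(1)[OF intF])
  have tfun_S: "tfun U (Mul (compose_affine 1 (- y) (pd q \<rho>)) (pd p \<phi>))" for y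
    unfolding tfun_def vanishes_off_def using K out\<phi> by (intro exI[of _ K]) (auto simp: vanishes_off_def)
  have ev_S: "ev (pd r (Mul (compose_affine 1 (- y) (pd q \<rho>)) (pd p \<phi>))) x = S y x" for x y
    by (simp add: S_def ev_affine ev_pd_affine)
  show "integrable lborel (\<lambda>x. S y x * w x)" for y
    using locint_tfun[OF w tfun_pd[OF tfun_S[of y], of r]] by (simp only: ev_S)
  \<comment> \<open>For fixed x in \<open>K\<close>, y \<mapsto> \<rho>(x - y) is a test function
    supported in \<open>K'\<close>. The inner sign of x - y cancels the sign of integration by
    parts.\<close>
  have F_F': "(LINT y|lborel. F x y) = (LINT y|lborel. F' x y)" for x
  proof (cases "x \<in> K")
    case True
    have "y \<in> K'" if "x - y \<in> L" for y using inK''[OF True that] by simp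
    then have "tfun U (compose_affine (-1) x \<rho>)"
      unfolding tfun_def vanishes_off_def using K' out\<rho> by (intro exI[of _ K']) (auto simp: ev_affine)
    from Gq(2)[OF this] have "(LINT y|lborel. ev \<rho> (x - y) * G q y) = (LINT y|lborel. ev (pd q \<rho>) (x - y) * u y)"
      by (simp add: ev_affine ev_pd_affine)
    moreover have "(LINT y|lborel. F x y) = ev (pd p \<phi>) x * H r x * (LINT y|lborel. ev \<rho> (x - y) * G q y)"
      unfolding F_def integral_mult_right_zero[symmetric] by (simp add: ac_simps)
    moreover have "(LINT y|lborel. F' x y) = ev (pd p \<phi>) x * H r x * (LINT y|lborel. ev (pd q \<rho>) (x - y) * u y)"
      unfolding F'_def integral_mult_right_zero[symmetric] by (simp add: ac_simps)
    ultimately show ?thesis by simp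
  next
    case False
    then show ?thesis by (simp add: F_def F'_def out\<phi>)
  qed
  \<comment> \<open>Now y is fixed and the derivative in direction \<open>r\<close> moves off
    \<open>w\<close>. It falls on a product of two functions of x, whence the two summands of
    \<open>S\<close>.\<close>
  have S_F': "(LINT x|lborel. F' x y) = - (indicator K' y * u y * (LINT x|lborel. S y x * w x))" for y
  proof -
    have "F' x y = indicator K' y * u y * (ev (Mul (compose_affine 1 (- y) (pd q \<rho>)) (pd p \<phi>)) x * H r x)" for x
      using inK''[of x "x - y"] out\<phi>[of x] out\<rho>[of "x - y"]
      by (cases "x \<in> K"; cases "x - y \<in> L") (auto simp: F'_def ev_affine)
    then have "(LINT x|lborel. F' x y) =
        indicator K' y * u y * (LINT x|lborel. ev (Mul (compose_affine 1 (- y) (pd q \<rho>)) (pd p \<phi>)) x * H r x)"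
      by (simp only: integral_mult_right_zero)
    then show ?thesis by (simp only: Hr(2)[OF tfun_S] ev_S mult_minus_right)
  qed
  show "integrable lborel (\<lambda>y. indicator K' y * u y * (LINT x|lborel. S y x * w x))"
    using integrable_minus[OF lborel_pair.integrable_snd[OF intF']] unfolding S_F' by (simp only: minus_minus)
  have "(LINT z|lborel. ev \<rho> z * C z) = (LINT x|lborel. LINT y|lborel. F x y)"
    unfolding C by (rule lborel_shear(2)[OF intF])
  also have "\<dots> = (LINT y|lborel. LINT x|lborel. F' x y)"
    unfolding F_F' by (rule lborel_pair.Fubini_integral[OF intF', symmetric])
  also have "\<dots> = - (LINT y|lborel. indicator K' y * u y * (LINT x|lborel. S y x * w x))"
    unfolding S_F' by (rule integral_minus)
  finally show "(LINT z|lborel. ev \<rho> z * C z) = - (LINT y|lborel. indicator K' y * u y * (LINT x|lborel. S y x * w x))" .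
qed

text \<open>This is d(du \<and> dw) = 0 evaluated on the directions \<open>m\<close>,
  \<open>k\<close>, \<open>l\<close>. The shifted alternating sum \<open>T\<close> is zero almost
  everywhere near 0, hence at 0 by continuity.\<close>

lemma minors_closed:
  fixes u w :: "'a::euclidean_space \<Rightarrow> real"
  assumes "open U" and G: "weak_grad U u G" and H: "weak_grad U w H" and \<phi>: "tfun U \<phi>"
  shows "(LINT x|lborel. ev (pd m \<phi>) x * (G k x * H l x - G l x * H k x)
      + ev (pd k \<phi>) x * (G l x * H m x - G m x * H l x)
      + ev (pd l \<phi>) x * (G m x * H k x - G k x * H m x)) = 0"
proof -
  obtain K where K: "K \<subseteq> U" "vanishes_off K \<phi>" using \<phi> by (auto simp: tfun_def)
  then have "compact K" by (simp add: vanishes_off_def)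
  \<comment> \<open>For shifts z shorter than \<open>\<delta>\<close> the points x - z with x in
    \<open>K\<close> stay in one compact subset \<open>K'\<close> of \<open>U\<close>.\<close>
  obtain \<delta> where \<delta>: "\<delta> > 0" "(\<Union>x\<in>K. cball x \<delta>) \<subseteq> U"
    using compact_subset_open_imp_cball_epsilon_subset[OF \<open>compact K\<close> \<open>open U\<close> K(1)] by blast
  define K' where "K' = {x - z | x z. x \<in> K \<and> z \<in> cball 0 \<delta>}"
  have "compact K'" unfolding K'_def using \<open>compact K\<close> by (rule compact_differences) simp
  have "K' \<subseteq> U"
  proof
    fix y assume "y \<in> K'"
    then obtain x z where "y = x - z" "x \<in> K" "z \<in> cball 0 \<delta>" by (auto simp: K'_def)
    then have "y \<in> (\<Union>x\<in>K. cball x \<delta>)" by (auto simp: dist_norm intro!: bexI[of _ x])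
    with \<delta>(2) show "y \<in> U" by blast
  qed
  have inK': "x - z \<in> K'" if "x \<in> K" "z \<in> ball 0 \<delta>" for x z
    using that ball_subset_cball[of 0 \<delta>] unfolding K'_def by blast
  \<comment> \<open>The indicator makes the shifted factor globally square integrable. It changes
    nothing for small shifts, since x - z is in \<open>K'\<close> wherever \<phi> lives.\<close>
  define C where "C p q r = corr (\<lambda>x. ev (pd p \<phi>) x * H r x) (\<lambda>y. indicator K' y * G q y)" for p q r
  define T where "T z = C m k l z - C m l k z + C k l m z - C k m l z + C l m k z - C l k m z" for z
  have Gm [measurable]: "G v \<in> borel_measurable borel" and Hm [measurable]: "H v \<in> borel_measurable borel" for v
    using G H unfolding weak_grad_def by (blast intro: locint_measurable)+
  have [measurable]: "K' \<in> sets borel" using \<open>compact K'\<close> by (rule borel_compact)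
  have "\<exists>B. \<forall>x. \<bar>ev (pd p \<phi>) x\<bar> \<le> B" for p
    using ev_bounded[OF vanishes_off_pd[OF K(2)], of p] by blast
  then obtain B where B: "\<And>p x. \<bar>ev (pd p \<phi>) x\<bar> \<le> B p" by metis
  have out: "x \<notin> K \<Longrightarrow> ev (pd p \<phi>) x = 0" for x p
    using vanishes_off_pd[OF K(2), of p] by (simp add: vanishes_off_def)
  have a1: "integrable lborel (\<lambda>x. ev (pd p \<phi>) x * H r x)" for p r
    using H by (intro locint_tfun[of U] tfun_pd \<phi>) (auto simp: weak_grad_def)
  have a2: "integrable lborel (\<lambda>x. (ev (pd p \<phi>) x * H r x)\<^sup>2)" for p r
  proof -
    have "integrable lborel (\<lambda>x. (ev (pd p \<phi>) x)\<^sup>2 * (H r x)\<^sup>2)"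
    proof (rule locint_bounded_mult[OF _ \<open>compact K\<close> K(1)])
      show "locint U (\<lambda>x. (H r x)\<^sup>2)" using H by (auto simp: weak_grad_def)
      show "\<bar>(ev (pd p \<phi>) x)\<^sup>2\<bar> \<le> (B p)\<^sup>2" for x
        using power_mono[OF B[of p x] abs_ge_zero, of 2] by simp
    qed (use out in auto)
    then show ?thesis by (simp add: power_mult_distrib)
  qed
  have b2: "integrable lborel (\<lambda>y. (indicator K' y * G q y)\<^sup>2)" for q
  proof -
    have "locint U (\<lambda>x. (G q x)\<^sup>2)" using G by (auto simp: weak_grad_def)
    then have "integrable lborel (\<lambda>x. indicator K' x *\<^sub>R (G q x)\<^sup>2)"
      using \<open>compact K'\<close> \<open>K' \<subseteq> U\<close> by (auto simp: locint_def set_integrable_def)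
    moreover have "(indicator K' y * G q y)\<^sup>2 = indicator K' y *\<^sub>R (G q y)\<^sup>2" for y
      by (auto simp: indicator_def)
    ultimately show ?thesis by simp
  qed
  have locC: "locint UNIV (C p q r)" for p q r
    unfolding C_def by (intro corr_measurable_bounded a2 b2) measurable
  have "isCont (C p q r) 0" for p q r
    unfolding C_def by (intro isCont_corr a1 a2 b2) measurable
  then have contT: "isCont T 0" unfolding T_def[abs_def] by (intro continuous_intros)
  have "locint UNIV T"
    unfolding T_def[abs_def] by (intro locint_add locint_diff locC)
  have "AE z in lborel. z \<in> ball 0 \<delta> \<longrightarrow> T z = 0"
  proof (rule fundamental_lemma[OF open_ball locint_subset[OF \<open>locint UNIV T\<close> subset_UNIV]])
    fix \<rho> :: "'a sexp" assume \<rho>: "tfun (ball 0 \<delta>) \<rho>"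
    define S where "S p q r y x = ev (pd r (pd q \<rho>)) (x - y) * ev (pd p \<phi>) x + ev (pd q \<rho>) (x - y) * ev (pd r (pd p \<phi>)) x"
      for p q r y x
    define I where "I p q r y = indicator K' y * u y * (LINT x|lborel. S p q r y x * w x)" for p q r y
    note * = corr_against_bump[OF G H K(2,1) \<open>compact K'\<close> \<open>K' \<subseteq> U\<close> inK' \<rho>, folded C_def S_def, folded I_def]
    \<comment> \<open>Exchanging the last two indices cancels the second derivatives of \<rho>;
      exchanging the first and the last cancels the second derivatives of \<phi>.\<close>
    have sum0: "S m k l y x - S m l k y x + S k l m y x - S k m l y x + S l m k y x - S l k m y x = 0" for x y
      unfolding S_def
      using pd_commute[of k l \<rho> "x - y"] pd_commute[of k m \<rho> "x - y"] pd_commute[of l m \<rho> "x - y"]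
        pd_commute[of k l \<phi> x] pd_commute[of k m \<phi> x] pd_commute[of l m \<phi> x]
      by simp
    have "I m k l y - I m l k y + I k l m y - I k m l y + I l m k y - I l k m y =
        indicator K' y * u y * (LINT x|lborel. (S m k l y x - S m l k y x + S k l m y x - S k m l y x + S l m k y x - S l k m y x) * w x)" for y
      unfolding I_def using *(4) by (simp add: algebra_simps)
    then have I0: "I m k l y - I m l k y + I k l m y - I k m l y + I l m k y - I l k m y = 0" for y
      by (simp add: sum0)
    have "(LINT z|lborel. ev \<rho> z * T z) =
        - (LINT y|lborel. I m k l y - I m l k y + I k l m y - I k m l y + I l m k y - I l k m y)"
      unfolding T_def using *(1,2,3) by (simp add: distrib_left right_diff_distrib)
    then show "(LINT z|lborel. ev \<rho> z * T z) = 0" by (simp add: I0)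
  qed
  then have T0: "T 0 = 0"
  proof (rule contrapos_pp)
    assume "T 0 \<noteq> 0"
    then obtain e where e: "e > 0" "\<And>z. dist 0 z < e \<Longrightarrow> T z \<noteq> 0"
      using continuous_at_avoid[OF contT] by metis
    show "\<not> (AE z in lborel. z \<in> ball 0 \<delta> \<longrightarrow> T z = 0)"
    proof
      assume "AE z in lborel. z \<in> ball 0 \<delta> \<longrightarrow> T z = 0"
      moreover have "ball (0 :: 'a) (min e \<delta>) \<noteq> {}" using e(1) \<open>\<delta> > 0\<close> by simp
      ultimately obtain z where "z \<in> ball 0 (min e \<delta>)" "z \<in> ball 0 \<delta> \<longrightarrow> T z = 0"
        using AE_lborel_ex_in_open[OF _ open_ball] by blast
      then show False using e(2)[of z] by simp
    qed
  qed
  have C0: "C p q r 0 = (LINT x|lborel. ev (pd p \<phi>) x * (G q x * H r x))" for p q r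
    unfolding C_def corr_def
  proof (rule Bochner_Integration.integral_cong[OF refl])
    fix x
    show "ev (pd p \<phi>) x * H r x * (indicator K' (x - 0) * G q (x - 0)) = ev (pd p \<phi>) x * (G q x * H r x)"
      using inK'[of x 0] \<open>\<delta> > 0\<close> out[of x p] by (cases "x \<in> K") auto
  qed
  have int: "integrable lborel (\<lambda>x. ev (pd p \<phi>) x * (G q x * H r x))" for p q r
  proof -
    have "integrable lborel (\<lambda>x. (ev (pd p \<phi>) x * H r x) * (indicator K' x * G q x))"
      by (intro integrable_mult_L2 a2 b2) measurable
    moreover have "(ev (pd p \<phi>) x * H r x) * (indicator K' x * G q x) = ev (pd p \<phi>) x * (G q x * H r x)" for x
      using inK'[of x 0] \<open>\<delta> > 0\<close> out[of x p] by (cases "x \<in> K") auto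
    ultimately show ?thesis by simp
  qed
  show ?thesis
    using T0 int unfolding T_def C0 by (simp add: distrib_left right_diff_distrib)
qed

subsection \<open>Components of Sobolev maps\<close>

lemma AE_lebesgue_on_iff:
  assumes "open (U :: 'a::euclidean_space set)"
  shows "(AE x in lebesgue_on U. P x) \<longleftrightarrow> (AE x in lborel. x \<in> U \<longrightarrow> P x)"
  using assms by (subst AE_restrict_space_iff) (auto simp: AE_completion_iff)

lemma Lp_loc_bounded_linear_measurable:
  assumes "\<Phi> \<in> Lp_loc p U" "bounded_linear \<Lambda>"
  shows "(\<lambda>x. \<Lambda> (\<Phi> x)) \<in> borel_measurable (lebesgue_on U)"
proof (rule measurable_compose[where f=\<Phi> and g=\<Lambda>])
  show "\<Phi> \<in> borel_measurable (lebesgue_on U)" using assms(1) by (simp add: Lp_loc_def)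
  show "\<Lambda> \<in> borel_measurable borel"
    using assms(2) by (intro borel_measurable_continuous_onI linear_continuous_on)
qed

lemma set_integrable_lebesgue_dominated:
  fixes g h :: "'a::euclidean_space \<Rightarrow> real"
  assumes "set_integrable lebesgue K h" and [measurable]: "g \<in> borel_measurable borel" and "compact K"
    and "AE x in lborel. x \<in> K \<longrightarrow> \<bar>g x\<bar> \<le> M * h x"
  shows "set_integrable lborel K g"
proof -
  have K [measurable]: "K \<in> sets borel" using \<open>compact K\<close> by (rule borel_compact)
  have m: "(\<lambda>x. indicator K x *\<^sub>R g x) \<in> borel_measurable lborel" by measurable
  have "integrable lebesgue (\<lambda>x. indicator K x *\<^sub>R g x)"
  proof (rule Bochner_Integration.integrable_bound)
    show "integrable lebesgue (\<lambda>x. M * (indicator K x *\<^sub>R h x))"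
      using assms(1) by (simp add: set_integrable_def)
    show "(\<lambda>x. indicator K x *\<^sub>R g x) \<in> borel_measurable lebesgue"
      using m by (rule measurable_completion)
    show "AE x in lebesgue. norm (indicator K x *\<^sub>R g x) \<le> norm (M * (indicator K x *\<^sub>R h x))"
      using AE_completion[OF assms(4)] by eventually_elim (auto simp: indicator_def)
  qed
  then show ?thesis unfolding set_integrable_def using integrable_completion[OF m] by blast
qed

text \<open>\<open>\<Lambda>\<close> extracts a scalar component of \<open>f\<close> or
  \<open>Df\<close>. Its bound M carries local integrability over to a Borel function equal to it
  almost everywhere, and the same representative serves both exponents.\<close>

lemma Lp_loc_borel_representative:
  fixes \<Phi> :: "'a::euclidean_space \<Rightarrow> 'c::real_normed_vector" and \<Lambda> :: "'c \<Rightarrow> real"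
  assumes "open U" and \<Phi>: "\<Phi> \<in> Lp_loc 1 U" and \<Lambda>: "bounded_linear \<Lambda>"
  shows "\<exists>g. locint U g \<and> (AE x in lborel. x \<in> U \<longrightarrow> g x = \<Lambda> (\<Phi> x)) \<and>
    (\<Phi> \<in> Lp_loc 2 U \<longrightarrow> locint U (\<lambda>x. (g x)\<^sup>2))"
proof -
  obtain M where M: "\<And>c. \<bar>\<Lambda> c\<bar> \<le> norm c * M" using bounded_linear.bounded[OF \<Lambda>] by auto
  have "(\<lambda>x. if x \<in> U then \<Lambda> (\<Phi> x) else 0) \<in> borel_measurable lebesgue"
    using Lp_loc_bounded_linear_measurable[OF \<Phi> \<Lambda>] \<open>open U\<close> by (intro borel_measurable_if_I) auto
  from completion_ex_borel_measurable_real[OF this]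
  obtain g where g: "g \<in> borel_measurable borel" "AE x in lborel. (if x \<in> U then \<Lambda> (\<Phi> x) else 0) = g x"
    by auto
  have eq: "AE x in lborel. x \<in> U \<longrightarrow> g x = \<Lambda> (\<Phi> x)"
    using g(2) by eventually_elim auto
  have "locint U g"
    unfolding locint_def
  proof safe
    fix K assume K: "compact K" "K \<subseteq> U"
    show "set_integrable lborel K g"
    proof (rule set_integrable_lebesgue_dominated[OF _ g(1) K(1)])
      show "set_integrable lebesgue K (\<lambda>x. norm (\<Phi> x) powr 1)" using \<Phi> K by (auto simp: Lp_loc_def)
      show "AE x in lborel. x \<in> K \<longrightarrow> \<bar>g x\<bar> \<le> M * norm (\<Phi> x) powr 1"
        using eq by eventually_elim (use K M in \<open>auto simp: mult.commute\<close>)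
    qed
  qed (rule g)
  moreover have "locint U (\<lambda>x. (g x)\<^sup>2)" if \<Phi>2: "\<Phi> \<in> Lp_loc 2 U"
    unfolding locint_def
  proof safe
    show m2: "(\<lambda>x. (g x)\<^sup>2) \<in> borel_measurable borel" using g(1) by measurable
    fix K assume K: "compact K" "K \<subseteq> U"
    show "set_integrable lborel K (\<lambda>x. (g x)\<^sup>2)"
    proof (rule set_integrable_lebesgue_dominated[OF _ m2 K(1)])
      show "set_integrable lebesgue K (\<lambda>x. norm (\<Phi> x) powr 2)" using \<Phi>2 K by (auto simp: Lp_loc_def)
      have le: "(\<Lambda> c)\<^sup>2 \<le> M\<^sup>2 * norm c powr 2" for c
        using power_mono[OF M[of c] abs_ge_zero, of 2] by (simp add: power_mult_distrib mult.commute powr_numeral)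
      show "AE x in lborel. x \<in> K \<longrightarrow> \<bar>(g x)\<^sup>2\<bar> \<le> M\<^sup>2 * norm (\<Phi> x) powr 2"
        using eq by eventually_elim (use K le in auto)
    qed
  qed
  ultimately show ?thesis using eq by blast
qed

lemma lebesgue_integral_inner_representative:
  fixes \<Phi> :: "'a::euclidean_space \<Rightarrow> 'c::real_normed_vector" and \<Lambda> :: "'c \<Rightarrow> 'd::euclidean_space"
  assumes "open U" and \<Phi>: "\<Phi> \<in> Lp_loc 1 U" and \<Lambda>: "bounded_linear \<Lambda>" and a: "tfun U a"
    and g: "g \<in> borel_measurable borel" "AE x in lborel. x \<in> U \<longrightarrow> g x = \<Lambda> (\<Phi> x) \<bullet> b"
  shows "(LINT x:U|lebesgue. ev a x *\<^sub>R \<Lambda> (\<Phi> x)) \<bullet> b = (LINT x|lborel. ev a x * g x)"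
proof -
  obtain M where M: "\<And>c. norm (\<Lambda> c) \<le> norm c * M" "M \<ge> 0"
    using bounded_linear.nonneg_bounded[OF \<Lambda>] by auto
  obtain K where K: "K \<subseteq> U" "vanishes_off K a" using a by (auto simp: tfun_def)
  then obtain B where B: "\<And>x. \<bar>ev a x\<bar> \<le> B" "B > 0" using ev_bounded by metis
  have "integrable lebesgue (\<lambda>x. indicator U x *\<^sub>R (ev a x *\<^sub>R \<Lambda> (\<Phi> x)))"
  proof (rule Bochner_Integration.integrable_bound)
    show "integrable lebesgue (\<lambda>x. (B * M) * (indicator K x *\<^sub>R (norm (\<Phi> x) powr 1)))"
      using \<Phi> K unfolding set_integrable_def[symmetric]
      by (intro integrable_mult_right) (auto simp: Lp_loc_def set_integrable_def vanishes_off_def)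
    have "(\<lambda>x. if x \<in> U then \<Lambda> (\<Phi> x) else 0) \<in> borel_measurable lebesgue"
      using Lp_loc_bounded_linear_measurable[OF \<Phi> \<Lambda>] \<open>open U\<close> by (intro borel_measurable_if_I) auto
    then have "(\<lambda>x. ev a x *\<^sub>R (if x \<in> U then \<Lambda> (\<Phi> x) else 0)) \<in> borel_measurable lebesgue"
      by (intro borel_measurable_scaleR) (auto intro: measurable_completion)
    moreover have "(\<lambda>x. ev a x *\<^sub>R (if x \<in> U then \<Lambda> (\<Phi> x) else 0)) = (\<lambda>x. indicator U x *\<^sub>R (ev a x *\<^sub>R \<Lambda> (\<Phi> x)))"
      by (auto simp: indicator_def)
    ultimately show "(\<lambda>x. indicator U x *\<^sub>R (ev a x *\<^sub>R \<Lambda> (\<Phi> x))) \<in> borel_measurable lebesgue"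
      by simp
    have "norm (indicator U x *\<^sub>R (ev a x *\<^sub>R \<Lambda> (\<Phi> x))) \<le> norm ((B * M) * (indicator K x *\<^sub>R (norm (\<Phi> x) powr 1)))" for x
    proof (cases "x \<in> K")
      case True
      have "\<bar>ev a x\<bar> * norm (\<Lambda> (\<Phi> x)) \<le> B * (norm (\<Phi> x) * M)"
        using B M by (intro mult_mono) auto
      then show ?thesis using True K B M by (auto simp: abs_mult ac_simps)
    qed (use K in \<open>auto simp: vanishes_off_def\<close>)
    then show "AE x in lebesgue. norm (indicator U x *\<^sub>R (ev a x *\<^sub>R \<Lambda> (\<Phi> x)))
        \<le> norm ((B * M) * (indicator K x *\<^sub>R (norm (\<Phi> x) powr 1)))"
      by (intro always_eventually allI)
  qed
  note int = this
  have m: "(\<lambda>x. ev a x * g x) \<in> borel_measurable lborel" using g(1) by measurable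
  have "(LINT x:U|lebesgue. ev a x *\<^sub>R \<Lambda> (\<Phi> x)) \<bullet> b
      = (LINT x|lebesgue. (indicator U x *\<^sub>R (ev a x *\<^sub>R \<Lambda> (\<Phi> x))) \<bullet> b)"
    unfolding set_lebesgue_integral_def by (rule integral_inner_left[symmetric]) (rule int)
  also have "\<dots> = (LINT x|lebesgue. ev a x * g x)"
  proof (rule integral_cong_AE)
    show "(\<lambda>x. (indicator U x *\<^sub>R (ev a x *\<^sub>R \<Lambda> (\<Phi> x))) \<bullet> b) \<in> borel_measurable lebesgue"
      using borel_measurable_integrable[OF int] by (intro borel_measurable_inner) auto
    show "(\<lambda>x. ev a x * g x) \<in> borel_measurable lebesgue" using m by (rule measurable_completion)
    show "AE x in lebesgue. (indicator U x *\<^sub>R (ev a x *\<^sub>R \<Lambda> (\<Phi> x))) \<bullet> b = ev a x * g x"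
      using AE_completion[OF g(2)] by eventually_elim (use K in \<open>auto simp: indicator_def vanishes_off_def\<close>)
  qed
  also have "\<dots> = (LINT x|lborel. ev a x * g x)" by (rule integral_completion[OF m])
  finally show ?thesis .
qed

lemma weak_differential_component:
  fixes f :: "'a::euclidean_space \<Rightarrow> 'd::euclidean_space"
  assumes "open U" and Df: "weak_differential_on U f Df"
    and u: "u \<in> borel_measurable borel" "AE x in lborel. x \<in> U \<longrightarrow> u x = f x \<bullet> b"
    and g: "g \<in> borel_measurable borel" "AE x in lborel. x \<in> U \<longrightarrow> g x = blinfun_apply (Df x) v \<bullet> b"
    and a: "tfun U a"
  shows "(LINT x|lborel. ev a x * g x) = - (LINT x|lborel. ev (pd v a) x * u x)"
proof -
  have f: "f \<in> Lp_loc 1 U" and Df1: "Df \<in> Lp_loc 1 U"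
    and weak: "(LINT x:U|lebesgue. ev a x *\<^sub>R blinfun_apply (Df x) v)
      = - (LINT x:U|lebesgue. ev (pd v a) x *\<^sub>R f x)"
    using Df tfun_imp_test_function_on[OF a] by (auto simp: weak_differential_on_def frechet_derivative_ev)
  have "(LINT x|lborel. ev a x * g x) = (LINT x:U|lebesgue. ev a x *\<^sub>R blinfun_apply (Df x) v) \<bullet> b"
    by (rule lebesgue_integral_inner_representative[OF \<open>open U\<close> Df1 blinfun.bounded_linear_left a g, symmetric])
  also have "\<dots> = - ((LINT x:U|lebesgue. ev (pd v a) x *\<^sub>R f x) \<bullet> b)"
    unfolding weak by simp
  also have "(LINT x:U|lebesgue. ev (pd v a) x *\<^sub>R f x) \<bullet> b = (LINT x|lborel. ev (pd v a) x * u x)"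
    by (rule lebesgue_integral_inner_representative[OF \<open>open U\<close> f bounded_linear_ident tfun_pd[OF a] u])
  finally show ?thesis .
qed

lemma bounded_linear_blinfun_inner: "bounded_linear (\<lambda>T. blinfun_apply T v \<bullet> b)"
  by (rule bounded_linear_compose[OF bounded_linear_inner_left blinfun.bounded_linear_left])

text \<open>Membership in \<open>W1p_loc\<close> supplies some weak differential \<open>Df'\<close>
  locally in L^2, while the given \<open>Df\<close> comes with L^1 only. By the fundamental lemma
  their components agree almost everywhere, so \<open>Df'\<close> provides integrability and
  \<open>Df\<close> the pointwise structure.\<close>

lemma W12_loc_weak_grad:
  fixes f :: "'a::euclidean_space \<Rightarrow> 'd::euclidean_space"
  assumes "open U" and f: "f \<in> W1p_loc 2 U" and Df: "weak_differential_on U f Df"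
  shows "\<exists>u G. weak_grad U u G \<and> (AE x in lborel. x \<in> U \<longrightarrow> u x = f x \<bullet> b) \<and>
    (\<forall>v. AE x in lborel. x \<in> U \<longrightarrow> G v x = blinfun_apply (Df x) v \<bullet> b)"
proof -
  obtain Df' where Df': "weak_differential_on U f Df'" "Df' \<in> Lp_loc 2 U"
    using f by (auto simp: W1p_loc_def)
  have L1: "f \<in> Lp_loc 1 U" "Df \<in> Lp_loc 1 U" "Df' \<in> Lp_loc 1 U"
    using Df Df' by (auto simp: weak_differential_on_def)
  obtain u where u: "locint U u" "AE x in lborel. x \<in> U \<longrightarrow> u x = f x \<bullet> b"
    using Lp_loc_borel_representative[OF \<open>open U\<close> L1(1) bounded_linear_inner_left, of b] by blast
  have "\<exists>g. locint U g \<and> locint U (\<lambda>x. (g x)\<^sup>2) \<and> (AE x in lborel. x \<in> U \<longrightarrow> g x = blinfun_apply (Df' x) v \<bullet> b)" for v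
    using Lp_loc_borel_representative[OF \<open>open U\<close> L1(3) bounded_linear_blinfun_inner, of v b] Df'(2) by blast
  then have "\<exists>G. \<forall>v. locint U (G v) \<and> locint U (\<lambda>x. (G v x)\<^sup>2) \<and>
      (AE x in lborel. x \<in> U \<longrightarrow> G v x = blinfun_apply (Df' x) v \<bullet> b)"
    by (intro choice allI)
  then obtain G where G: "\<And>v. locint U (G v)" "\<And>v. locint U (\<lambda>x. (G v x)\<^sup>2)"
    "\<And>v. AE x in lborel. x \<in> U \<longrightarrow> G v x = blinfun_apply (Df' x) v \<bullet> b"
    by blast
  note comp = weak_differential_component[OF \<open>open U\<close> _ locint_measurable[OF u(1)] u(2)]
  have weak: "(LINT x|lborel. ev a x * G v x) = - (LINT x|lborel. ev (pd v a) x * u x)" if "tfun U a" for v a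
    by (rule comp[OF Df'(1) locint_measurable[OF G(1)] G(3) that])
  have "AE x in lborel. x \<in> U \<longrightarrow> G v x = blinfun_apply (Df x) v \<bullet> b" for v
  proof -
    obtain g where g: "locint U g" "AE x in lborel. x \<in> U \<longrightarrow> g x = blinfun_apply (Df x) v \<bullet> b"
      using Lp_loc_borel_representative[OF \<open>open U\<close> L1(2) bounded_linear_blinfun_inner, of v b] by blast
    have "AE x in lborel. x \<in> U \<longrightarrow> G v x - g x = 0"
    proof (rule fundamental_lemma[OF \<open>open U\<close>])
      show "locint U (\<lambda>x. G v x - g x)" using G(1) g(1) by (rule locint_diff)
      fix a assume a: "tfun U a"
      then show "(LINT x|lborel. ev a x * (G v x - g x)) = 0"
        using weak[OF a, of v] comp[OF Df locint_measurable[OF g(1)] g(2) a]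
          locint_tfun[OF G(1) a, of v] locint_tfun[OF g(1) a]
        by (simp add: right_diff_distrib)
    qed
    with g(2) show ?thesis by eventually_elim auto
  qed
  moreover have "weak_grad U u G" using u(1) G weak by (auto simp: weak_grad_def)
  ultimately show ?thesis using u(2) by blast
qed

subsection \<open>The dichotomy between diagonal and antidiagonal type\<close>

text \<open>If all minors vanish, any two columns are proportional in the strong sense that
  \<open>w\<close>, built from the entries of row \<open>i\<close>, lies in the kernel. Injectivity
  makes column \<open>k\<close> nonzero, so some row \<open>i\<close> makes \<open>w\<close>
  nonzero.\<close>

lemma injective_matrix_nonzero_minor:
  fixes A :: "real ^ 'n::finite ^ 'n"
  assumes n: "CARD('n) \<ge> 2" and inj: "inj ((*v) A)"
  shows "\<exists>i j k l. A $ i $ k * A $ j $ l - A $ i $ l * A $ j $ k \<noteq> 0"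
proof (rule ccontr)
  assume "\<not> ?thesis"
  then have zero: "A $ i $ k * A $ j $ l = A $ i $ l * A $ j $ k" for i j k l by auto
  have col: "A *v axis k 1 = column k A" for k by (rule matrix_vector_mult_basis)
  have ker: "w = 0" if "A *v w = 0" for w using injD[OF inj, of w 0] that by simp
  obtain k l :: 'n where "k \<noteq> l" using n by (metis card_2_iff' ex_card)
  have "column k A \<noteq> 0" using ker[of "axis k 1"] col by (auto simp: axis_eq_0_iff)
  then obtain i where i: "A $ i $ k \<noteq> 0" by (auto simp: vec_eq_iff column_def)
  define w where "w = A $ i $ l *\<^sub>R axis k (1::real) - A $ i $ k *\<^sub>R axis l 1"
  have "A *v w = A $ i $ l *\<^sub>R column k A - A $ i $ k *\<^sub>R column l A"
    unfolding w_def by (simp add: matrix_vector_mult_diff_distrib matrix_vector_mult_scaleR col)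
  also have "\<dots> = 0" using zero by (simp add: vec_eq_iff column_def)
  finally have "A *v w = 0" .
  then have "w = 0" by (rule ker)
  then have "w $ l = 0" by simp
  then show False using i \<open>k \<noteq> l\<close> by (simp add: w_def axis_def)
qed

abbreviation e\<^sub>x :: "'n::finite \<Rightarrow> (real ^ 'n) \<times> (real ^ 'n)" where "e\<^sub>x i \<equiv> (axis i 1, 0)"
abbreviation e\<^sub>y :: "'n::finite \<Rightarrow> (real ^ 'n) \<times> (real ^ 'n)" where "e\<^sub>y i \<equiv> (0, axis i 1)"

lemma inner_matrix_axis: "((A :: real ^ 'n ^ 'n::finite) *v axis k 1) \<bullet> axis i 1 = A $ i $ k"
  by (simp add: matrix_vector_mult_basis column_def inner_axis)

text \<open>Restricting \<open>L\<close> to one factor shows that the upper nonzero block is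
  injective. Only minors of the first component enter: it alone tells the two types apart.\<close>

lemma split_bijective_cases:
  fixes L :: "(real ^ 'n::finite) \<times> (real ^ 'n) \<Rightarrow> (real ^ 'n) \<times> (real ^ 'n)"
  assumes n: "CARD('n) \<ge> 2" and L: "split_linear L" "bij L"
  defines "\<mu> \<equiv> \<lambda>e i j k l. (L (e k) \<bullet> e\<^sub>x i) * (L (e l) \<bullet> e\<^sub>x j) - (L (e l) \<bullet> e\<^sub>x i) * (L (e k) \<bullet> e\<^sub>x j)"
  shows "(\<forall>i h. L (0, h) \<bullet> e\<^sub>x i = 0 \<and> L (h, 0) \<bullet> e\<^sub>y i = 0) \<and>
      (\<exists>i j k l. \<mu> e\<^sub>x i j k l \<noteq> 0) \<and> (\<forall>i j k l. \<mu> e\<^sub>y i j k l = 0) \<or>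
    (\<forall>i h. L (h, 0) \<bullet> e\<^sub>x i = 0 \<and> L (0, h) \<bullet> e\<^sub>y i = 0) \<and>
      (\<forall>i j k l. \<mu> e\<^sub>x i j k l = 0) \<and> (\<exists>i j k l. \<mu> e\<^sub>y i j k l \<noteq> 0)"
  using L(1) unfolding split_linear_def
proof (elim disjE exE)
  fix A D :: "real ^ 'n ^ 'n" assume *: "\<forall>x y. L (x, y) = (A *v x, D *v y)"
  have "inj ((*v) A)"
  proof (rule injI)
    fix x x' assume "A *v x = A *v x'"
    then have "L (x, 0) = L (x', 0)" using * by simp
    then show "x = x'" using L(2) by (auto dest: injD[OF bij_is_inj])
  qed
  from injective_matrix_nonzero_minor[OF n this] show ?thesis
    using * by (intro disjI1) (simp add: \<mu>_def inner_matrix_axis)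
next
  fix B C :: "real ^ 'n ^ 'n" assume *: "\<forall>x y. L (x, y) = (B *v y, C *v x)"
  have "inj ((*v) B)"
  proof (rule injI)
    fix y y' assume "B *v y = B *v y'"
    then have "L (0, y) = L (0, y')" using * by simp
    then show "y = y'" using L(2) by (auto dest: injD[OF bij_is_inj])
  qed
  from injective_matrix_nonzero_minor[OF n this] show ?thesis
    using * by (intro disjI2) (simp add: \<mu>_def inner_matrix_axis)
qed

text \<open>Fubini provides one x in \<open>X\<close> for which the alternative holds for almost
  every y. Whether this x is in \<open>S\<close> decides membership of almost every y in
  \<open>T\<close>, and since \<open>T\<close> does not see x, the same case holds almost everywhere
  on the product.\<close>

lemma AE_product_dichotomy:
  fixes X :: "'a::euclidean_space set" and Y :: "'b::euclidean_space set"
  assumes "open X"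
    and *: "AE z in lborel. z \<in> X \<times> Y \<longrightarrow> (P z \<and> fst z \<in> S \<and> snd z \<notin> T) \<or> (Q z \<and> fst z \<notin> S \<and> snd z \<in> T)"
  shows "(AE z in lborel. z \<in> X \<times> Y \<longrightarrow> P z) \<or> (AE z in lborel. z \<in> X \<times> Y \<longrightarrow> Q z)"
proof (cases "X = {}")
  case False
  from AE_lborel_pairD[OF *] have
    "AE x in lborel. AE y in lborel. x \<in> X \<and> y \<in> Y \<longrightarrow> (x \<in> S \<and> y \<notin> T) \<or> (x \<notin> S \<and> y \<in> T)"
    by (elim eventually_mono) auto
  from AE_lborel_ex_in_open[OF this \<open>open X\<close> False]
  obtain x where x: "AE y in lborel. y \<in> Y \<longrightarrow> (x \<in> S \<and> y \<notin> T) \<or> (x \<notin> S \<and> y \<in> T)" by auto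
  have "AE z in lborel. snd (z :: 'a \<times> 'b) \<in> Y \<longrightarrow> (x \<in> S \<and> snd z \<notin> T) \<or> (x \<notin> S \<and> snd z \<in> T)"
    using AE_lborel_prod_swap[OF AE_lborel_pair_fst[OF x]] by simp
  with * have **: "AE z in lborel. z \<in> X \<times> Y \<longrightarrow> (if x \<in> S then P z else Q z)"
    by eventually_elim auto
  then show ?thesis by (cases "x \<in> S") auto
qed auto

lemma locint_mult_L2:
  assumes g: "locint U g" "locint U (\<lambda>x. (g x)\<^sup>2)" and h: "locint U h" "locint U (\<lambda>x. (h x)\<^sup>2)"
  shows "locint U (\<lambda>x. g x * h x)"
  unfolding locint_def
proof safe
  note [measurable] = locint_measurable[OF g(1)] locint_measurable[OF h(1)]
  show "(\<lambda>x. g x * h x) \<in> borel_measurable borel" by measurable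
  fix K assume K: "compact K" "K \<subseteq> U"
  have [measurable]: "K \<in> sets borel" using K(1) by (rule borel_compact)
  have sq: "(indicator K x * c)\<^sup>2 = indicator K x *\<^sub>R c\<^sup>2" for c :: real and x by (auto simp: indicator_def)
  have "integrable lborel (\<lambda>x. (indicator K x * g x) * (indicator K x * h x))"
    using g(2) h(2) K by (intro integrable_mult_L2) (auto simp: sq locint_def set_integrable_def)
  moreover have "(indicator K x * g x) * (indicator K x * h x) = indicator K x *\<^sub>R (g x * h x)" for x
    by (auto simp: indicator_def)
  ultimately show "set_integrable lborel K (\<lambda>x. g x * h x)" by (simp add: set_integrable_def)
qed

lemma locint_minor:
  assumes "weak_grad U u G" "weak_grad U w H"
  shows "locint U (\<lambda>x. G k x * H l x - G l x * H k x)"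
  using assms by (intro locint_diff locint_mult_L2) (auto simp: weak_grad_def)

text \<open>The other two terms of \<open>minors_closed\<close> are minors for the pairs (l, m) and
  (m, k). Each product in them has a factor in direction \<open>m\<close> and one in direction
  \<open>k\<close> or \<open>l\<close>, so either alternative of \<open>mixed\<close> makes them
  vanish.\<close>

lemma minor_weak_derivative_zero:
  fixes u w :: "'a::euclidean_space \<Rightarrow> real"
  assumes "open U" and G: "weak_grad U u G" and H: "weak_grad U w H" and a: "tfun U a"
    and mixed: "AE z in lborel. z \<in> U \<longrightarrow> (G m z = 0 \<and> H m z = 0) \<or> (G k z = 0 \<and> H k z = 0 \<and> G l z = 0 \<and> H l z = 0)"
  shows "(LINT z|lborel. ev (pd m a) z * (G k z * H l z - G l z * H k z)) = 0"
proof -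
  have [measurable]: "G v \<in> borel_measurable borel" "H v \<in> borel_measurable borel" for v
    using G H unfolding weak_grad_def by (blast intro: locint_measurable)+
  have out: "z \<notin> U \<Longrightarrow> ev (pd v a) z = 0" for v z
    using tfun_pd[OF a, of v] by (auto simp: tfun_def vanishes_off_def)
  have "(LINT z|lborel. ev (pd m a) z * (G k z * H l z - G l z * H k z)) =
      (LINT x|lborel. ev (pd m a) x * (G k x * H l x - G l x * H k x)
        + ev (pd k a) x * (G l x * H m x - G m x * H l x)
        + ev (pd l a) x * (G m x * H k x - G k x * H m x))"
    by (rule integral_cong_AE, measurable, measurable)
      (use mixed in \<open>eventually_elim, use out in \<open>metis (no_types, lifting) add.right_neutral diff_self mult_zero_left mult_zero_right\<close>\<close>)
  also have "\<dots> = 0" by (rule minors_closed[OF \<open>open U\<close> G H a])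
  finally show ?thesis .
qed

lemma weak_grad_indep_of_snd:
  fixes u :: "'a::euclidean_space \<times> 'b::euclidean_space \<Rightarrow> real"
  assumes "open X" "open Y" "connected Y" and G: "weak_grad (X \<times> Y) u G"
    and zero: "\<And>h. AE z in lborel. z \<in> X \<times> Y \<longrightarrow> G (0, h) z = 0"
  obtains \<alpha> where "AE z in lborel. z \<in> X \<times> Y \<longrightarrow> u z = \<alpha> (fst z)"
proof (rule indep_of_snd[OF assms(1-3)])
  show "locint (X \<times> Y) u" using G by (simp add: weak_grad_def)
  fix a h assume a: "tfun (X \<times> Y) a"
  have "AE z in lborel. ev a z * G (0, h) z = 0"
    using zero[of h] by eventually_elim (use a in \<open>auto simp: tfun_def vanishes_off_def\<close>)
  then have "(LINT z|lborel. ev a z * G (0, h) z) = 0" by (rule integral_eq_zero_AE)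
  then show "(LINT z|lborel. ev (pd (0, h) a) z * u z) = 0" using G a by (simp add: weak_grad_def)
qed (rule that)

lemma weak_grad_indep_of_fst:
  fixes u :: "'a::euclidean_space \<times> 'b::euclidean_space \<Rightarrow> real"
  assumes "open X" "connected X" "open Y" and G: "weak_grad (X \<times> Y) u G"
    and zero: "\<And>h. AE z in lborel. z \<in> X \<times> Y \<longrightarrow> G (h, 0) z = 0"
  obtains \<beta> where "AE z in lborel. z \<in> X \<times> Y \<longrightarrow> u z = \<beta> (snd z)"
proof (rule indep_of_fst[OF assms(1-3)])
  show "locint (X \<times> Y) u" using G by (simp add: weak_grad_def)
  fix a h assume a: "tfun (X \<times> Y) a"
  have "AE z in lborel. ev a z * G (h, 0) z = 0"
    using zero[of h] by eventually_elim (use a in \<open>auto simp: tfun_def vanishes_off_def\<close>)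
  then have "(LINT z|lborel. ev a z * G (h, 0) z) = 0" by (rule integral_eq_zero_AE)
  then show "(LINT z|lborel. ev (pd (h, 0) a) z * u z) = 0" using G a by (simp add: weak_grad_def)
qed (rule that)

theorem theorem1p2:
  fixes \<Omega>\<^sub>1 \<Omega>\<^sub>2 :: "(real ^ 'n::finite) set"
    and f :: "(real ^ 'n) \<times> (real ^ 'n) \<Rightarrow> (real ^ 'n) \<times> (real ^ 'n)"
    and Df :: "(real ^ 'n) \<times> (real ^ 'n) \<Rightarrow>
               ((real ^ 'n) \<times> (real ^ 'n)) \<Rightarrow>\<^sub>L ((real ^ 'n) \<times> (real ^ 'n))"
  assumes "CARD('n) \<ge> 2"
    and "open \<Omega>\<^sub>1" and "connected \<Omega>\<^sub>1"
    and "open \<Omega>\<^sub>2" and "connected \<Omega>\<^sub>2"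
    and "f \<in> W1p_loc 2 (\<Omega>\<^sub>1 \<times> \<Omega>\<^sub>2)"
    and "weak_differential_on (\<Omega>\<^sub>1 \<times> \<Omega>\<^sub>2) f Df"
    and "AE z in lebesgue_on (\<Omega>\<^sub>1 \<times> \<Omega>\<^sub>2).
           split_linear (blinfun_apply (Df z)) \<and> bij (blinfun_apply (Df z))"
  shows "ae_split_on \<Omega>\<^sub>1 \<Omega>\<^sub>2 f"
proof -
  define U where "U = \<Omega>\<^sub>1 \<times> \<Omega>\<^sub>2"
  have "open U" unfolding U_def using assms(2,4) by (rule open_Times)
  have "\<exists>u G. weak_grad U u G \<and> (AE z in lborel. z \<in> U \<longrightarrow> u z = f z \<bullet> b) \<and>
      (\<forall>v. AE z in lborel. z \<in> U \<longrightarrow> G v z = blinfun_apply (Df z) v \<bullet> b)" for b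
    by (rule W12_loc_weak_grad[OF \<open>open U\<close>]) (use assms(6,7) in \<open>simp_all add: U_def\<close>)
  then have "\<exists>u. \<forall>b. \<exists>G. weak_grad U (u b) G \<and> (AE z in lborel. z \<in> U \<longrightarrow> (u b) z = f z \<bullet> b) \<and>
      (\<forall>v. AE z in lborel. z \<in> U \<longrightarrow> G v z = blinfun_apply (Df z) v \<bullet> b)"
    by (intro choice allI)
  then obtain u where "\<forall>b. \<exists>G. weak_grad U (u b) G \<and> (AE z in lborel. z \<in> U \<longrightarrow> (u b) z = f z \<bullet> b) \<and>
      (\<forall>v. AE z in lborel. z \<in> U \<longrightarrow> G v z = blinfun_apply (Df z) v \<bullet> b)"
    by blast
  then have "\<exists>G. \<forall>b. weak_grad U (u b) (G b) \<and> (AE z in lborel. z \<in> U \<longrightarrow> (u b) z = f z \<bullet> b) \<and>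
      (\<forall>v. AE z in lborel. z \<in> U \<longrightarrow> (G b) v z = blinfun_apply (Df z) v \<bullet> b)"
    by (rule choice)
  then obtain G where G: "\<And>b. weak_grad U (u b) (G b)"
    and u: "\<And>b. AE z in lborel. z \<in> U \<longrightarrow> u b z = f z \<bullet> b"
    and G_Df: "\<And>b v. AE z in lborel. z \<in> U \<longrightarrow> G b v z = blinfun_apply (Df z) v \<bullet> b"
    by blast
  \<comment> \<open>The rows are always components of the first half of \<open>f\<close>; the
    argument \<open>e\<close> selects whether both columns are x- or y-directions.\<close>
  define \<mu> where "\<mu> e i j k l z = G (e\<^sub>x i) (e k) z * G (e\<^sub>x j) (e l) z - G (e\<^sub>x i) (e l) z * G (e\<^sub>x j) (e k) z"
    for e :: "'n \<Rightarrow> (real ^ 'n) \<times> (real ^ 'n)" and i j k l z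
  define diag where "diag z \<longleftrightarrow> (\<forall>i h. blinfun_apply (Df z) (0, h) \<bullet> e\<^sub>x i = 0 \<and> blinfun_apply (Df z) (h, 0) \<bullet> e\<^sub>y i = 0)" for z
  define anti where "anti z \<longleftrightarrow> (\<forall>i h. blinfun_apply (Df z) (h, 0) \<bullet> e\<^sub>x i = 0 \<and> blinfun_apply (Df z) (0, h) \<bullet> e\<^sub>y i = 0)" for z
  \<comment> \<open>The null sets depend on the direction, so only finitely many basis directions
    are collected into one statement.\<close>
  have G_basis: "AE z in lborel. \<forall>i k. z \<in> U \<longrightarrow> G (e\<^sub>x i) (e k) z = blinfun_apply (Df z) (e k) \<bullet> e\<^sub>x i"
    for e :: "'n \<Rightarrow> (real ^ 'n) \<times> (real ^ 'n)"
    by (intro eventually_all_finite G_Df)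
  have cases: "AE z in lborel. z \<in> U \<longrightarrow>
      diag z \<and> (\<exists>i j k l. \<mu> e\<^sub>x i j k l z \<noteq> 0) \<and> (\<forall>i j k l. \<mu> e\<^sub>y i j k l z = 0) \<or>
      anti z \<and> (\<forall>i j k l. \<mu> e\<^sub>x i j k l z = 0) \<and> (\<exists>i j k l. \<mu> e\<^sub>y i j k l z \<noteq> 0)"
    using assms(8)[unfolded AE_lebesgue_on_iff[OF \<open>open U\<close>[unfolded U_def]], folded U_def]
      G_basis[of e\<^sub>x] G_basis[of e\<^sub>y]
  proof eventually_elim
    case (elim z)
    show ?case
    proof
      assume z: "z \<in> U"
      then have "split_linear (blinfun_apply (Df z))" "bij (blinfun_apply (Df z))" using elim(1) by auto
      from split_bijective_cases[OF assms(1) this] show "diag z \<and> (\<exists>i j k l. \<mu> e\<^sub>x i j k l z \<noteq> 0) \<and> (\<forall>i j k l. \<mu> e\<^sub>y i j k l z = 0) \<or>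
      anti z \<and> (\<forall>i j k l. \<mu> e\<^sub>x i j k l z = 0) \<and> (\<exists>i j k l. \<mu> e\<^sub>y i j k l z \<noteq> 0)"
        using elim(2,3) z unfolding \<mu>_def diag_def anti_def by simp
    qed
  qed
  \<comment> \<open>At diagonal points the first half of \<open>f\<close> has no y-derivative, at
    antidiagonal points no x-derivative; one of the alternatives always applies.\<close>
  have mixed: "AE z in lborel. z \<in> U \<longrightarrow>
      (G (e\<^sub>x i) (0, h) z = 0 \<and> G (e\<^sub>x j) (0, h) z = 0) \<or>
      (G (e\<^sub>x i) (k, 0) z = 0 \<and> G (e\<^sub>x j) (k, 0) z = 0 \<and> G (e\<^sub>x i) (l, 0) z = 0 \<and> G (e\<^sub>x j) (l, 0) z = 0)" for i j h k l
    using cases G_Df[of "e\<^sub>x i" "(0, h)"] G_Df[of "e\<^sub>x j" "(0, h)"] G_Df[of "e\<^sub>x i" "(k, 0)"]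
      G_Df[of "e\<^sub>x j" "(k, 0)"] G_Df[of "e\<^sub>x i" "(l, 0)"] G_Df[of "e\<^sub>x j" "(l, 0)"]
    by eventually_elim (auto simp: diag_def anti_def)
  have mixed': "AE z in lborel. z \<in> U \<longrightarrow>
      (G (e\<^sub>x i) (h, 0) z = 0 \<and> G (e\<^sub>x j) (h, 0) z = 0) \<or>
      (G (e\<^sub>x i) (0, k) z = 0 \<and> G (e\<^sub>x j) (0, k) z = 0 \<and> G (e\<^sub>x i) (0, l) z = 0 \<and> G (e\<^sub>x j) (0, l) z = 0)" for i j h k l
    using cases G_Df[of "e\<^sub>x i" "(h, 0)"] G_Df[of "e\<^sub>x j" "(h, 0)"] G_Df[of "e\<^sub>x i" "(0, k)"]
      G_Df[of "e\<^sub>x j" "(0, k)"] G_Df[of "e\<^sub>x i" "(0, l)"] G_Df[of "e\<^sub>x j" "(0, l)"]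
    by eventually_elim (auto simp: diag_def anti_def)
  have "\<exists>\<alpha>. AE z in lborel. z \<in> U \<longrightarrow> \<mu> e\<^sub>x i j k l z = \<alpha> (fst z)" for i j k l
    unfolding U_def \<mu>_def
    by (rule indep_of_snd[OF assms(2,4,5) locint_minor[OF G[unfolded U_def] G[unfolded U_def]]])
      (use minor_weak_derivative_zero[OF \<open>open U\<close> G G _ mixed] in \<open>auto simp: U_def\<close>)
  then have "\<exists>\<alpha>. \<forall>i j k l. AE z in lborel. z \<in> U \<longrightarrow> \<mu> e\<^sub>x i j k l z = \<alpha> i j k l (fst z)"
    by (intro choice allI)
  then obtain \<alpha> where \<alpha>: "\<And>i j k l. AE z in lborel. z \<in> U \<longrightarrow> \<mu> e\<^sub>x i j k l z = \<alpha> i j k l (fst z)"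
    by blast
  have "\<exists>\<beta>. AE z in lborel. z \<in> U \<longrightarrow> \<mu> e\<^sub>y i j k l z = \<beta> (snd z)" for i j k l
    unfolding U_def \<mu>_def
    by (rule indep_of_fst[OF assms(2,3,4) locint_minor[OF G[unfolded U_def] G[unfolded U_def]]])
      (use minor_weak_derivative_zero[OF \<open>open U\<close> G G _ mixed'] in \<open>auto simp: U_def\<close>)
  then have "\<exists>\<beta>. \<forall>i j k l. AE z in lborel. z \<in> U \<longrightarrow> \<mu> e\<^sub>y i j k l z = \<beta> i j k l (snd z)"
    by (intro choice allI)
  then obtain \<beta> where \<beta>: "\<And>i j k l. AE z in lborel. z \<in> U \<longrightarrow> \<mu> e\<^sub>y i j k l z = \<beta> i j k l (snd z)"
    by blast
  have "AE z in lborel. \<forall>i j k l. z \<in> U \<longrightarrow> \<mu> e\<^sub>x i j k l z = \<alpha> i j k l (fst z)"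
    "AE z in lborel. \<forall>i j k l. z \<in> U \<longrightarrow> \<mu> e\<^sub>y i j k l z = \<beta> i j k l (snd z)"
    by (intro eventually_all_finite \<alpha> \<beta>)+
  \<comment> \<open>Rewriting the minors by \<open>\<alpha>\<close> and \<open>\<beta>\<close> turns
    the two types into membership of each coordinate in a fixed set, as
    \<open>AE_product_dichotomy\<close> requires.\<close>
  with cases have "AE z in lborel. z \<in> \<Omega>\<^sub>1 \<times> \<Omega>\<^sub>2 \<longrightarrow>
      (diag z \<and> fst z \<in> {x. \<exists>i j k l. \<alpha> i j k l x \<noteq> 0} \<and> snd z \<notin> {y. \<exists>i j k l. \<beta> i j k l y \<noteq> 0}) \<or>
      (anti z \<and> fst z \<notin> {x. \<exists>i j k l. \<alpha> i j k l x \<noteq> 0} \<and> snd z \<in> {y. \<exists>i j k l. \<beta> i j k l y \<noteq> 0})"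
    unfolding U_def[symmetric] by eventually_elim simp
  from AE_product_dichotomy[OF assms(2) this]
  show ?thesis
  proof (elim disjE)
    assume diag: "AE z in lborel. z \<in> \<Omega>\<^sub>1 \<times> \<Omega>\<^sub>2 \<longrightarrow> diag z"
    \<comment> \<open>With a single type almost everywhere, the block of vanishing derivatives is
      the same throughout, so each component depends on one factor only.\<close>
    have "\<exists>\<alpha>. AE z in lborel. z \<in> U \<longrightarrow> u (e\<^sub>x i) z = \<alpha> (fst z)" for i
    proof -
      have "AE z in lborel. z \<in> U \<longrightarrow> G (e\<^sub>x i) (0, h) z = 0" for h
        using diag G_Df[of "e\<^sub>x i" "(0, h)"] by eventually_elim (auto simp: diag_def U_def)
      then show ?thesis unfolding U_def by (rule weak_grad_indep_of_snd[OF assms(2,4,5) G[unfolded U_def]]) blast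
    qed
    then have "\<exists>f\<^sub>1. \<forall>i. AE z in lborel. z \<in> U \<longrightarrow> u (e\<^sub>x i) z = f\<^sub>1 i (fst z)"
      by (intro choice allI)
    then obtain f\<^sub>1 where f\<^sub>1: "\<And>i. AE z in lborel. z \<in> U \<longrightarrow> u (e\<^sub>x i) z = f\<^sub>1 i (fst z)"
      by blast
    have "\<exists>\<beta>. AE z in lborel. z \<in> U \<longrightarrow> u (e\<^sub>y i) z = \<beta> (snd z)" for i
    proof -
      have "AE z in lborel. z \<in> U \<longrightarrow> G (e\<^sub>y i) (h, 0) z = 0" for h
        using diag G_Df[of "e\<^sub>y i" "(h, 0)"] by eventually_elim (auto simp: diag_def U_def)
      then show ?thesis unfolding U_def by (rule weak_grad_indep_of_fst[OF assms(2,3,4) G[unfolded U_def]]) blast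
    qed
    then have "\<exists>f\<^sub>2. \<forall>i. AE z in lborel. z \<in> U \<longrightarrow> u (e\<^sub>y i) z = f\<^sub>2 i (snd z)"
      by (intro choice allI)
    then obtain f\<^sub>2 where f\<^sub>2: "\<And>i. AE z in lborel. z \<in> U \<longrightarrow> u (e\<^sub>y i) z = f\<^sub>2 i (snd z)"
      by blast
    have "AE z in lborel. \<forall>i. z \<in> U \<longrightarrow> f z \<bullet> e\<^sub>x i = f\<^sub>1 i (fst z) \<and> f z \<bullet> e\<^sub>y i = f\<^sub>2 i (snd z)"
    proof (rule eventually_all_finite)
      fix i show "AE z in lborel. z \<in> U \<longrightarrow> f z \<bullet> e\<^sub>x i = f\<^sub>1 i (fst z) \<and> f z \<bullet> e\<^sub>y i = f\<^sub>2 i (snd z)"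
        using f\<^sub>1[of i] f\<^sub>2[of i] u[of "e\<^sub>x i"] u[of "e\<^sub>y i"] by eventually_elim auto
    qed
    then have "AE z in lborel. z \<in> U \<longrightarrow> f z = ((\<chi> i. f\<^sub>1 i (fst z)), (\<chi> i. f\<^sub>2 i (snd z)))"
      by eventually_elim (auto simp: prod_eq_iff vec_eq_iff inner_prod_def inner_axis)
    then show ?thesis
      unfolding ae_split_on_def AE_lebesgue_on_iff[OF \<open>open U\<close>[unfolded U_def]] U_def
      by (intro exI[of _ "\<lambda>x. \<chi> i. f\<^sub>1 i x"] exI[of _ "\<lambda>y. \<chi> i. f\<^sub>2 i y"] disjI1)
  next
    assume anti: "AE z in lborel. z \<in> \<Omega>\<^sub>1 \<times> \<Omega>\<^sub>2 \<longrightarrow> anti z"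
    have "\<exists>\<beta>. AE z in lborel. z \<in> U \<longrightarrow> u (e\<^sub>x i) z = \<beta> (snd z)" for i
    proof -
      have "AE z in lborel. z \<in> U \<longrightarrow> G (e\<^sub>x i) (h, 0) z = 0" for h
        using anti G_Df[of "e\<^sub>x i" "(h, 0)"] by eventually_elim (auto simp: anti_def U_def)
      then show ?thesis unfolding U_def by (rule weak_grad_indep_of_fst[OF assms(2,3,4) G[unfolded U_def]]) blast
    qed
    then have "\<exists>f\<^sub>2. \<forall>i. AE z in lborel. z \<in> U \<longrightarrow> u (e\<^sub>x i) z = f\<^sub>2 i (snd z)"
      by (intro choice allI)
    then obtain f\<^sub>2 where f\<^sub>2: "\<And>i. AE z in lborel. z \<in> U \<longrightarrow> u (e\<^sub>x i) z = f\<^sub>2 i (snd z)"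
      by blast
    have "\<exists>\<alpha>. AE z in lborel. z \<in> U \<longrightarrow> u (e\<^sub>y i) z = \<alpha> (fst z)" for i
    proof -
      have "AE z in lborel. z \<in> U \<longrightarrow> G (e\<^sub>y i) (0, h) z = 0" for h
        using anti G_Df[of "e\<^sub>y i" "(0, h)"] by eventually_elim (auto simp: anti_def U_def)
      then show ?thesis unfolding U_def by (rule weak_grad_indep_of_snd[OF assms(2,4,5) G[unfolded U_def]]) blast
    qed
    then have "\<exists>f\<^sub>1. \<forall>i. AE z in lborel. z \<in> U \<longrightarrow> u (e\<^sub>y i) z = f\<^sub>1 i (fst z)"
      by (intro choice allI)
    then obtain f\<^sub>1 where f\<^sub>1: "\<And>i. AE z in lborel. z \<in> U \<longrightarrow> u (e\<^sub>y i) z = f\<^sub>1 i (fst z)"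
      by blast
    have "AE z in lborel. \<forall>i. z \<in> U \<longrightarrow> f z \<bullet> e\<^sub>x i = f\<^sub>2 i (snd z) \<and> f z \<bullet> e\<^sub>y i = f\<^sub>1 i (fst z)"
    proof (rule eventually_all_finite)
      fix i show "AE z in lborel. z \<in> U \<longrightarrow> f z \<bullet> e\<^sub>x i = f\<^sub>2 i (snd z) \<and> f z \<bullet> e\<^sub>y i = f\<^sub>1 i (fst z)"
        using f\<^sub>1[of i] f\<^sub>2[of i] u[of "e\<^sub>x i"] u[of "e\<^sub>y i"] by eventually_elim auto
    qed
    then have "AE z in lborel. z \<in> U \<longrightarrow> f z = ((\<chi> i. f\<^sub>2 i (snd z)), (\<chi> i. f\<^sub>1 i (fst z)))"
      by eventually_elim (auto simp: prod_eq_iff vec_eq_iff inner_prod_def inner_axis)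
    then show ?thesis
      unfolding ae_split_on_def AE_lebesgue_on_iff[OF \<open>open U\<close>[unfolded U_def]] U_def
      by (intro exI[of _ "\<lambda>x. \<chi> i. f\<^sub>1 i x"] exI[of _ "\<lambda>y. \<chi> i. f\<^sub>2 i y"] disjI2)
  qed
qed

end
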